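(* Let $M$ be a smooth connected manifold of dimension $n>1$, and let $F$ and $\widetilde F$ be two Finsler metrics on $M$ whose geodesic sprays $S$ and $\widetilde S$ are projectively related, i.e. $\widetilde S=S-2P\,\mathcal{C}$ for a positively $1$-homogeneous function $P\in C^\infty(T_0M)$ (the projective factor). Suppose that $F$ has constant flag curvature. Then $\widetilde F$ also has constant flag curvature if and only if $P$ is a Hamel function, i.e. $d_hd_JP=0$, where $h$ is the horizontal projector of $S$.
   Context: $M$ is a smooth connected $n$-manifold, $n>1$; $TM$ is its tangent bundle with induced coordinates $(x^i,y^i)$, and $T_0M=TM\setminus\{0\}$ is the slit tangent bundle. $\mathcal{C}=y^i\frac{\partial}{\partial y^i}$ is the Liouville vector field and $J=\frac{\partial}{\partial y^i}\otimes dx^i$ is the vertical endomorphism. All objects are smooth on $T_0M$. For a $(1,1)$-tensor $K$ on $T_0M$, $i_K$ acts on functions by $i_Kf=0$ and on $p$-forms by $(i_K\omega)(X_1,\dots,X_p)=\sum_i\omega(X_1,\dots,KX_i,\dots,X_p)$, and $d_K:=i_K\circ d-d\circ i_K$ (so $d_Kf=df\circ K$ for functions). A spray is a smooth vector field $S$ on $T_0M$ with $JS=\mathcal{C}$ and $[\mathcal{C},S]=S$. With $[S,K]:=\mathcal{L}_SK$ for a $(1,1)$-tensor $K$, its horizontal and vertical projectors are $h=\frac12(\mathrm{Id}-[S,J])$ and $v=\frac12(\mathrm{Id}+[S,J])$, and its Jacobi endomorphism is $\Phi=v\circ[S,h]$. A geodesic of a spray is a smooth curve on $M$ whose velocity is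 an integral curve of the spray. Two sprays are projectively related (projectively equivalent) if their geodesics coincide up to an orientation preserving reparametrisation; equivalently, $\widetilde S=S-2P\,\mathcal{C}$ with $P\in C^\infty(T_0M)$ positively $1$-homogeneous. A Finsler metric on $M$ is a continuous function $F:TM\to[0,\infty)$, smooth and positive on $T_0M$, positively $1$-homogeneous on the fibres, with $\left(\frac12\frac{\partial^2F^2}{\partial y^i\partial y^j}\right)$ positive definite on $T_0M$. Its geodesic spray $S$ is the unique spray with $i_S\,dd_JF^2=-dF^2$. $F$ has scalar flag curvature if there is a $0$-homogeneous function $\kappa\in C^\infty(T_0M)$ such that the Jacobi endomorphism of its geodesic spray is $\Phi=\kappa(F^2J-F\,d_JF\otimes\mathcal{C})$; it has constant flag curvature if moreover $\kappa$ is constant. *)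

theory Defs
  imports "HOL-Analysis.Analysis"
begin

section \<open>Smooth maps between open subsets of normed spaces\<close>

text \<open>Intended for open \<open>U\<close>: all iterated directional derivatives of order at most \<open>k\<close> exist, are
  continuous, and those of order below \<open>k\<close> are Frechet differentiable.\<close>

primrec Ck_on :: "nat \<Rightarrow> 'a::real_normed_vector set \<Rightarrow> ('a \<Rightarrow> 'b::real_normed_vector) \<Rightarrow> bool" where
  "Ck_on 0 U f \<longleftrightarrow> continuous_on U f"
| "Ck_on (Suc k) U f \<longleftrightarrow>
     (\<forall>z\<in>U. f differentiable (at z)) \<and> (\<forall>u. Ck_on k U (\<lambda>z. frechet_derivative f (at z) u))"

definition smooth_on :: "'a::real_normed_vector set \<Rightarrow> ('a \<Rightarrow> 'b::real_normed_vector) \<Rightarrow> bool" where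
  "smooth_on U f \<longleftrightarrow> (\<forall>k. Ck_on k U f)"

section \<open>Smooth manifolds\<close>

text \<open>A chart is a coordinate domain with a coordinate map; the values of the map outside the
  domain are irrelevant. The underlying set of a manifold is the union of the domains of an atlas.\<close>

record ('a, 'e) chart =
  chart_dom :: "'a set"
  chart_map :: "'a \<Rightarrow> 'e"

definition chart_range :: "('a, 'e) chart \<Rightarrow> 'e set" where
  "chart_range c = chart_map c ` chart_dom c"

definition chart_inv :: "('a, 'e) chart \<Rightarrow> 'e \<Rightarrow> 'a" where
  "chart_inv c = inv_into (chart_dom c) (chart_map c)"

definition transition :: "('a, 'e) chart \<Rightarrow> ('a, 'e) chart \<Rightarrow> 'e \<Rightarrow> 'e" where
  "transition c c' = chart_map c' \<circ> chart_inv c"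

definition points :: "('a, 'e) chart set \<Rightarrow> 'a set" where
  "points A = (\<Union>c\<in>A. chart_dom c)"

definition charts_at :: "('a, 'e) chart set \<Rightarrow> 'a \<Rightarrow> ('a, 'e) chart set" where
  "charts_at A p = {c \<in> A. p \<in> chart_dom c}"

text \<open>For a smooth atlas this is the usual manifold topology, in which every chart is a
  homeomorphism of an open set onto its range.\<close>

definition manifold_topology :: "('a, 'e::topological_space) chart set \<Rightarrow> 'a topology" where
  "manifold_topology A =
     topology_generated_by {chart_dom c \<inter> chart_map c -` W | c W. c \<in> A \<and> open W}"

definition smooth_atlas :: "('a, 'e::real_normed_vector) chart set \<Rightarrow> bool" where
  "smooth_atlas A \<longleftrightarrow>
     (\<forall>c\<in>A. inj_on (chart_map c) (chart_dom c) \<and> open (chart_range c)) \<and>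
     (\<forall>c\<in>A. \<forall>c'\<in>A. open (chart_map c ` (chart_dom c \<inter> chart_dom c')) \<and>
        smooth_on (chart_map c ` (chart_dom c \<inter> chart_dom c')) (transition c c'))"

definition smooth_manifold :: "('a, 'e::real_normed_vector) chart set \<Rightarrow> bool" where
  "smooth_manifold A \<longleftrightarrow> smooth_atlas A \<and>
     Hausdorff_space (manifold_topology A) \<and> second_countable (manifold_topology A)"

definition smooth_function ::
    "('a, 'e::real_normed_vector) chart set \<Rightarrow> ('a \<Rightarrow> real) \<Rightarrow> bool" where
  "smooth_function A f \<longleftrightarrow> (\<forall>c\<in>A. smooth_on (chart_range c) (f \<circ> chart_inv c))"

text \<open>A tangent vector at \<open>p\<close> assigns to each chart around \<open>p\<close> its components in that chart, subject
  to the transformation law \<open>v\<^sup>i' = (\<partial>x\<^sup>i'/\<partial>x\<^sup>i) v\<^sup>i\<close>. It is \<open>0\<close> on all other charts, so that it is determined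
  by its components in any single chart around \<open>p\<close>.\<close>

definition tangent_space ::
    "('a, 'e::real_normed_vector) chart set \<Rightarrow> 'a \<Rightarrow> (('a, 'e) chart \<Rightarrow> 'e) set" where
  "tangent_space A p = {v.
     (\<forall>c\<in>charts_at A p. \<forall>c'\<in>charts_at A p.
        v c' = frechet_derivative (transition c c') (at (chart_map c p)) (v c)) \<and>
     (\<forall>c. c \<notin> charts_at A p \<longrightarrow> v c = 0)}"

section \<open>Tensor calculus on a manifold\<close>

text \<open>Tensor fields are given by their components: \<open>X q c\<close>, \<open>K q c\<close> and \<open>\<omega> q c\<close> are the values at the
  point \<open>q\<close> of a vector field, a \<open>(1,1)\<close>-tensor field and a differential form, expressed in the chart
  \<open>c\<close>. Values at charts that are not around \<open>q\<close> are irrelevant. The operations below are the usual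
  coordinate formulas, and are compatible with changes of charts. A form takes a list of tangent
  vectors; its restriction to lists of length \<open>p\<close> is its homogeneous part of degree \<open>p\<close>, so that \<open>form\<close>
  stands for the whole exterior algebra and \<open>p\<close> need not be passed as a parameter.\<close>

type_synonym ('a, 'e) vfield = "'a \<Rightarrow> ('a, 'e) chart \<Rightarrow> 'e"
type_synonym ('a, 'e) tensor11 = "'a \<Rightarrow> ('a, 'e) chart \<Rightarrow> 'e \<Rightarrow> 'e"
type_synonym ('a, 'e) form = "'a \<Rightarrow> ('a, 'e) chart \<Rightarrow> 'e list \<Rightarrow> real"

definition smooth_vfield ::
    "('a, 'e::real_normed_vector) chart set \<Rightarrow> ('a, 'e) vfield \<Rightarrow> bool" where
  "smooth_vfield A X \<longleftrightarrow> (\<forall>q\<in>points A. X q \<in> tangent_space A q) \<and>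
     (\<forall>c\<in>A. smooth_on (chart_range c) (\<lambda>z. X (chart_inv c z) c))"

definition vfield_eq :: "('a, 'e) chart set \<Rightarrow> ('a, 'e) vfield \<Rightarrow> ('a, 'e) vfield \<Rightarrow> bool" where
  "vfield_eq A X Y \<longleftrightarrow> (\<forall>q\<in>points A. \<forall>c\<in>charts_at A q. X q c = Y q c)"

definition tensor_eq :: "('a, 'e) chart set \<Rightarrow> ('a, 'e) tensor11 \<Rightarrow> ('a, 'e) tensor11 \<Rightarrow> bool" where
  "tensor_eq A K L \<longleftrightarrow> (\<forall>q\<in>points A. \<forall>c\<in>charts_at A q. \<forall>u. K q c u = L q c u)"

definition form_eq :: "('a, 'e) chart set \<Rightarrow> ('a, 'e) form \<Rightarrow> ('a, 'e) form \<Rightarrow> bool" where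
  "form_eq A \<omega> \<eta> \<longleftrightarrow> (\<forall>q\<in>points A. \<forall>c\<in>charts_at A q. \<forall>us. \<omega> q c us = \<eta> q c us)"

definition chart_deriv ::
    "('a, 'e::real_normed_vector) chart \<Rightarrow> ('a \<Rightarrow> 'b::real_normed_vector) \<Rightarrow> 'a \<Rightarrow> 'e \<Rightarrow> 'b" where
  "chart_deriv c f q = frechet_derivative (f \<circ> chart_inv c) (at (chart_map c q))"

definition lie_bracket ::
    "('a, 'e::real_normed_vector) vfield \<Rightarrow> ('a, 'e) vfield \<Rightarrow> ('a, 'e) vfield" where
  "lie_bracket X Y q c =
     chart_deriv c (\<lambda>q. Y q c) q (X q c) - chart_deriv c (\<lambda>q. X q c) q (Y q c)"

text \<open>The rule \<open>(\<L>\<^sub>S K) Y = [S, K Y] - K [S, Y]\<close>, applied to the local vector field \<open>Y\<close> that has constant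
  components \<open>u\<close> in the chart \<open>c\<close>; the result is tensorial in \<open>Y\<close>.\<close>

definition lie_tensor ::
    "('a, 'e::real_normed_vector) vfield \<Rightarrow> ('a, 'e) tensor11 \<Rightarrow> ('a, 'e) tensor11" where
  "lie_tensor S K q c u =
     lie_bracket S (\<lambda>q c. K q c u) q c - K q c (lie_bracket S (\<lambda>q c. u) q c)"

definition fun_form :: "('a \<Rightarrow> real) \<Rightarrow> ('a, 'e) form" where
  "fun_form f q c us = (if us = [] then f q else 0)"

text \<open>\<open>d\<omega>(u\<^sub>0, \<dots>, u\<^sub>p) = \<Sum>\<^sub>i (-1)\<^sup>i u\<^sub>i(\<omega>(u\<^sub>0, \<dots>, u\<^sub>p without u\<^sub>i))\<close> on coordinate-constant fields, whose
  brackets vanish.\<close>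

definition ext_d :: "('a, 'e::real_normed_vector) form \<Rightarrow> ('a, 'e) form" where
  "ext_d \<omega> q c us = (\<Sum>i<length us. (-1) ^ i *
     chart_deriv c (\<lambda>q. \<omega> q c (take i us @ drop (Suc i) us)) q (us ! i))"

definition ins_tensor :: "('a, 'e) tensor11 \<Rightarrow> ('a, 'e) form \<Rightarrow> ('a, 'e) form" where
  "ins_tensor K \<omega> q c us = (\<Sum>i<length us. \<omega> q c (us[i := K q c (us ! i)]))"

definition ins_vfield :: "('a, 'e) vfield \<Rightarrow> ('a, 'e) form \<Rightarrow> ('a, 'e) form" where
  "ins_vfield X \<omega> q c us = \<omega> q c (X q c # us)"

definition d_tensor :: "('a, 'e::real_normed_vector) tensor11 \<Rightarrow> ('a, 'e) form \<Rightarrow> ('a, 'e) form" where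
  "d_tensor K \<omega> q c us = ins_tensor K (ext_d \<omega>) q c us - ext_d (ins_tensor K \<omega>) q c us"

section \<open>The tangent bundle and the slit tangent bundle\<close>

type_synonym ('m, 'e) tangent = "'m \<times> (('m, 'e) chart \<Rightarrow> 'e)"

definition tangent_bundle :: "('m, 'e::real_normed_vector) chart set \<Rightarrow> ('m, 'e) tangent set" where
  "tangent_bundle A = {(p, v). p \<in> points A \<and> v \<in> tangent_space A p}"

definition slit_bundle :: "('m, 'e::real_normed_vector) chart set \<Rightarrow> ('m, 'e) tangent set" where
  "slit_bundle A = {(p, v) \<in> tangent_bundle A. v \<noteq> (\<lambda>_. 0)}"

definition induced_chart ::
    "('m, 'e) tangent set \<Rightarrow> ('m, 'e) chart \<Rightarrow> (('m, 'e) tangent, 'e \<times> 'e) chart" where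
  "induced_chart B c =
     \<lparr>chart_dom = {(p, v) \<in> B. p \<in> chart_dom c}, chart_map = (\<lambda>(p, v). (chart_map c p, v c))\<rparr>"

definition tangent_atlas ::
    "('m, 'e::real_normed_vector) chart set \<Rightarrow> (('m, 'e) tangent, 'e \<times> 'e) chart set" where
  "tangent_atlas A = induced_chart (tangent_bundle A) ` A"

definition slit_atlas ::
    "('m, 'e::real_normed_vector) chart set \<Rightarrow> (('m, 'e) tangent, 'e \<times> 'e) chart set" where
  "slit_atlas A = induced_chart (slit_bundle A) ` A"

definition fibre_scale :: "real \<Rightarrow> ('m, 'e::real_vector) tangent \<Rightarrow> ('m, 'e) tangent" where
  "fibre_scale r = (\<lambda>(p, v). (p, \<lambda>c. r *\<^sub>R v c))"

definition pos_homogeneous_on ::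
    "('m, 'e::real_vector) tangent set \<Rightarrow> nat \<Rightarrow> (('m, 'e) tangent \<Rightarrow> real) \<Rightarrow> bool" where
  "pos_homogeneous_on B k f \<longleftrightarrow> (\<forall>q\<in>B. \<forall>r>0. f (fibre_scale r q) = r ^ k * f q)"

text \<open>In a chart of the slit atlas a tangent vector has components \<open>(a, b)\<close>, standing for
  \<open>a\<^sup>i \<partial>/\<partial>x\<^sup>i + b\<^sup>i \<partial>/\<partial>y\<^sup>i\<close>.\<close>

definition liouville :: "(('m, 'e::real_vector) tangent, 'e \<times> 'e) vfield" where
  "liouville q c = (0, snd (chart_map c q))"

definition vert_endo :: "(('m, 'e::real_vector) tangent, 'e \<times> 'e) tensor11" where
  "vert_endo q c u = (0, fst u)"

section \<open>Sprays\<close>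

definition spray ::
    "('m, 'e::real_normed_vector) chart set \<Rightarrow> (('m, 'e) tangent, 'e \<times> 'e) vfield \<Rightarrow> bool" where
  "spray A S \<longleftrightarrow> smooth_vfield (slit_atlas A) S \<and>
     vfield_eq (slit_atlas A) (\<lambda>q c. vert_endo q c (S q c)) liouville \<and>
     vfield_eq (slit_atlas A) (lie_bracket liouville S) S"

definition hor_proj ::
    "(('m, 'e::real_normed_vector) tangent, 'e \<times> 'e) vfield \<Rightarrow> (('m, 'e) tangent, 'e \<times> 'e) tensor11" where
  "hor_proj S q c u = (1/2) *\<^sub>R (u - lie_tensor S vert_endo q c u)"

definition vert_proj ::
    "(('m, 'e::real_normed_vector) tangent, 'e \<times> 'e) vfield \<Rightarrow> (('m, 'e) tangent, 'e \<times> 'e) tensor11" where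
  "vert_proj S q c u = (1/2) *\<^sub>R (u + lie_tensor S vert_endo q c u)"

definition jacobi_endo ::
    "(('m, 'e::real_normed_vector) tangent, 'e \<times> 'e) vfield \<Rightarrow> (('m, 'e) tangent, 'e \<times> 'e) tensor11" where
  "jacobi_endo S q c u = vert_proj S q c (lie_tensor S (hor_proj S) q c u)"

definition projective_factor ::
    "('m, 'e::real_normed_vector) chart set \<Rightarrow> (('m, 'e) tangent, 'e \<times> 'e) vfield \<Rightarrow>
     (('m, 'e) tangent, 'e \<times> 'e) vfield \<Rightarrow> (('m, 'e) tangent \<Rightarrow> real) \<Rightarrow> bool" where
  "projective_factor A S S' P \<longleftrightarrow> smooth_function (slit_atlas A) P \<and>
     pos_homogeneous_on (slit_bundle A) 1 P \<and>
     vfield_eq (slit_atlas A) S' (\<lambda>q c. S q c - (2 * P q) *\<^sub>R liouville q c)"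

definition hamel_function ::
    "('m, 'e::real_normed_vector) chart set \<Rightarrow> (('m, 'e) tangent, 'e \<times> 'e) vfield \<Rightarrow>
     (('m, 'e) tangent \<Rightarrow> real) \<Rightarrow> bool" where
  "hamel_function A S P \<longleftrightarrow>
     form_eq (slit_atlas A) (d_tensor (hor_proj S) (d_tensor vert_endo (fun_form P))) (\<lambda>q c us. 0)"

section \<open>Finsler metrics\<close>

definition dy :: "'n::finite \<Rightarrow> ((real^'n) \<times> (real^'n) \<Rightarrow> real) \<Rightarrow> (real^'n) \<times> (real^'n) \<Rightarrow> real" where
  "dy i f z = frechet_derivative f (at z) (0, axis i 1)"

definition metric_tensor ::
    "(('m, real^'n) tangent \<Rightarrow> real) \<Rightarrow> ('m, real^'n) tangent \<Rightarrow>
     (('m, real^'n) tangent, (real^'n) \<times> (real^'n)) chart \<Rightarrow> real^'n^'n" where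
  "metric_tensor F q c =
     (\<chi> i j. 1/2 * dy i (dy j (\<lambda>z. (F (chart_inv c z))\<^sup>2)) (chart_map c q))"

definition finsler_metric ::
    "('m, real^'n) chart set \<Rightarrow> (('m, real^'n) tangent \<Rightarrow> real) \<Rightarrow> bool" where
  "finsler_metric A F \<longleftrightarrow>
     (\<forall>q\<in>tangent_bundle A. F q \<ge> 0) \<and>
     continuous_map (manifold_topology (tangent_atlas A)) euclideanreal F \<and>
     smooth_function (slit_atlas A) F \<and>
     (\<forall>q\<in>slit_bundle A. F q > 0) \<and>
     pos_homogeneous_on (tangent_bundle A) 1 F \<and>
     (\<forall>q\<in>slit_bundle A. \<forall>c\<in>charts_at (slit_atlas A) q.
        \<forall>u. u \<noteq> 0 \<longrightarrow> u \<bullet> (metric_tensor F q c *v u) > 0)"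

definition geodesic_spray ::
    "('m, real^'n) chart set \<Rightarrow> (('m, real^'n) tangent \<Rightarrow> real) \<Rightarrow>
     (('m, real^'n) tangent, (real^'n) \<times> (real^'n)) vfield \<Rightarrow> bool" where
  "geodesic_spray A F S \<longleftrightarrow> spray A S \<and>
     form_eq (slit_atlas A)
       (ins_vfield S (ext_d (d_tensor vert_endo (fun_form (\<lambda>q. (F q)\<^sup>2)))))
       (\<lambda>q c us. - ext_d (fun_form (\<lambda>q. (F q)\<^sup>2)) q c us)"

text \<open>\<open>F\<close> has scalar flag curvature with curvature function \<open>\<kappa>\<close>.\<close>

definition flag_curvature ::
    "('m, real^'n) chart set \<Rightarrow> (('m, real^'n) tangent \<Rightarrow> real) \<Rightarrow>
     (('m, real^'n) tangent \<Rightarrow> real) \<Rightarrow> bool" where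
  "flag_curvature A F \<kappa> \<longleftrightarrow> smooth_function (slit_atlas A) \<kappa> \<and>
     pos_homogeneous_on (slit_bundle A) 0 \<kappa> \<and>
     (\<exists>S. geodesic_spray A F S \<and>
        tensor_eq (slit_atlas A) (jacobi_endo S)
          (\<lambda>q c u. \<kappa> q *\<^sub>R ((F q)\<^sup>2 *\<^sub>R vert_endo q c u -
             (F q * d_tensor vert_endo (fun_form F) q c [u]) *\<^sub>R liouville q c)))"

definition constant_flag_curvature ::
    "('m, real^'n) chart set \<Rightarrow> (('m, real^'n) tangent \<Rightarrow> real) \<Rightarrow> bool" where
  "constant_flag_curvature A F \<longleftrightarrow>
     (\<exists>\<kappa>. flag_curvature A F \<kappa> \<and> (\<exists>k. \<forall>q\<in>slit_bundle A. \<kappa> q = k))"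

end

theory Submission
  imports Defs
begin

text \<open>In induced coordinates write \<open>S = (y, s)\<close>, \<open>V\<^sub>a = \<partial>/\<partial>y\<close> in direction \<open>a\<close>, \<open>H\<^sub>a\<close> for the horizontal lift of
  \<open>a\<close>, \<open>E = F\<^sup>2\<close> and \<open>R\<close> for the curvature, \<open>\<Phi>(a, b) = (0, R a)\<close>. The Hamel condition
  \<open>H\<^sub>a V\<^sub>b P = H\<^sub>b V\<^sub>a P\<close> is equivalent to its contraction \<open>S(V\<^sub>a P) = \<partial>\<^sub>a P\<close> with \<open>y\<close>. The deformed curvature is
  \<open>R' a = R a + \<Xi> a + \<tau>(a) y\<close> with \<open>\<Xi> = P\<^sup>2 - S P\<close>, and \<open>\<tau>(a) + V\<^sub>a \<Xi> / 2 = 3/2 (\<partial>\<^sub>a P - S(V\<^sub>a P))\<close>.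
  If both curvatures are constant, differentiating \<open>k E + \<Xi> = k' E'\<close> vertically gives
  \<open>\<tau>(a) = - V\<^sub>a \<Xi> / 2\<close>, i.e. the Hamel condition.

  Conversely, for Hamel \<open>P\<close> one has \<open>R' a = \<rho> a - V\<^sub>a \<rho> / 2 y\<close> with \<open>\<rho> = k E + \<Xi>\<close>, and \<open>V E'\<close> annihilates
  \<open>R'\<close>, so \<open>\<kappa> = \<rho>/E'\<close> depends on the base point only. Schur's lemma is of no use when \<open>n = 2\<close>;
  instead \<open>3 H'\<^sub>a \<rho> = V\<^sub>a \<psi>\<close> for an explicit \<open>\<psi>\<close> that is \<open>3\<close>-homogeneous, which turns into
  \<open>2 E' \<partial>\<^sub>a \<kappa> = V\<^sub>a E' \<partial>\<^sub>y \<kappa>\<close>. Differentiating this vertically along some \<open>a \<noteq> 0\<close> with \<open>V\<^sub>a E' = 0\<close>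
  and using convexity of \<open>E'\<close> yields \<open>\<partial>\<kappa> = 0\<close>.\<close>

section \<open>Calculus of smooth functions\<close>

text \<open>The direction comes first, so that \<open>dd u\<close> is an operator on functions and
  mixed derivatives are iterates \<open>dd w (dd u f)\<close>.\<close>

definition dd :: "'a::real_normed_vector \<Rightarrow> ('a \<Rightarrow> 'b::real_normed_vector) \<Rightarrow> 'a \<Rightarrow> 'b" where
  "dd u f z = frechet_derivative f (at z) u"

lemma dd_eqI: "(f has_derivative f') (at z) \<Longrightarrow> dd u f z = f' u"
  unfolding dd_def by (metis frechet_derivative_at)

lemma has_derivative_dd: "f differentiable (at z) \<Longrightarrow> (f has_derivative (\<lambda>u. dd u f z)) (at z)"
  unfolding dd_def by (simp add: frechet_derivative_works)

lemma has_derivative_cong_open: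
  assumes "open W" "z \<in> W" "\<And>w. w \<in> W \<Longrightarrow> f w = g w"
  shows "(f has_derivative f') (at z) \<longleftrightarrow> (g has_derivative f') (at z)"
  using has_derivative_transform_within_open[of f f' z UNIV W g]
    has_derivative_transform_within_open[of g f' z UNIV W f] assms by auto

lemma dd_cong:
  assumes "open W" "z \<in> W" "\<And>w. w \<in> W \<Longrightarrow> f w = g w"
  shows "dd u f z = dd u g z"
  unfolding dd_def frechet_derivative_def by (simp add: has_derivative_cong_open[OF assms])

lemma differentiable_cong_open:
  assumes "open W" "z \<in> W" "\<And>w. w \<in> W \<Longrightarrow> f w = g w"
  shows "f differentiable (at z) \<longleftrightarrow> g differentiable (at z)"
  unfolding differentiable_def by (simp add: has_derivative_cong_open[OF assms])

lemma Ck_on_Suc: "Ck_on (Suc k) W f \<longleftrightarrow> (\<forall>z\<in>W. f differentiable (at z)) \<and> (\<forall>u. Ck_on k W (dd u f))"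
  by (simp add: dd_def[abs_def])

declare Ck_on.simps(2) [simp del]

lemma Ck_on_cong:
  assumes "open W" "\<And>w. w \<in> W \<Longrightarrow> f w = g w"
  shows "Ck_on k W f \<longleftrightarrow> Ck_on k W g"
  using assms(2)
proof (induction k arbitrary: f g)
  case 0
  then show ?case by (auto intro: continuous_on_cong)
next
  case (Suc k)
  have "Ck_on k W (dd u f) \<longleftrightarrow> Ck_on k W (dd u g)" for u
    by (intro Suc.IH dd_cong[OF assms(1)] Suc.prems)
  moreover have "f differentiable (at z) \<longleftrightarrow> g differentiable (at z)" if "z \<in> W" for z
    by (intro differentiable_cong_open[OF assms(1) that] Suc.prems)
  ultimately show ?case by (simp add: Ck_on_Suc)
qed

lemma smooth_on_cong:
  assumes "open W" "\<And>w. w \<in> W \<Longrightarrow> f w = g w"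
  shows "smooth_on W f \<longleftrightarrow> smooth_on W g"
  unfolding smooth_on_def using Ck_on_cong[OF assms] by auto

lemma Ck_on_Suc_imp: "Ck_on (Suc k) W f \<Longrightarrow> Ck_on k W f"
proof (induction k arbitrary: f)
  case 0
  then show ?case
    by (auto simp: Ck_on_Suc intro!: continuous_at_imp_continuous_on differentiable_imp_continuous_within)
next
  case (Suc k)
  then show ?case by (metis Ck_on_Suc)
qed

lemma smooth_on_differentiable: "smooth_on W f \<Longrightarrow> z \<in> W \<Longrightarrow> f differentiable (at z)"
  unfolding smooth_on_def using Ck_on_Suc by blast

lemma smooth_on_has_derivative:
  "smooth_on W f \<Longrightarrow> z \<in> W \<Longrightarrow> (f has_derivative (\<lambda>u. dd u f z)) (at z)"
  by (intro has_derivative_dd smooth_on_differentiable)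

lemma smooth_on_dd: "smooth_on W f \<Longrightarrow> smooth_on W (dd u f)"
  unfolding smooth_on_def using Ck_on_Suc by blast

text \<open>The family \<open>D\<close> need only be a derivative on the open set \<open>W\<close>.
  The closure lemmas below are inductions on the order, with \<open>D\<close> read off from the
  matching differentiation rule.\<close>

lemma Ck_on_SucI:
  assumes "open W" and d: "\<And>z. z \<in> W \<Longrightarrow> (f has_derivative (\<lambda>u. D u z)) (at z)" and "\<And>u. Ck_on k W (D u)"
  shows "Ck_on (Suc k) W f"
proof -
  have "Ck_on k W (dd u f)" for u
    using assms(3) Ck_on_cong[OF assms(1), of "dd u f" "D u"] dd_eqI[OF d] by blast
  then show ?thesis using d differentiableI by (metis Ck_on_Suc)
qed

lemma Ck_on_has_derivative:
  "Ck_on (Suc k) W f \<Longrightarrow> z \<in> W \<Longrightarrow> (f has_derivative (\<lambda>u. dd u f z)) (at z)"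
  using Ck_on_Suc has_derivative_dd by blast

lemma Ck_on_dd: "Ck_on (Suc k) W f \<Longrightarrow> Ck_on k W (dd u f)"
  using Ck_on_Suc by blast

section \<open>Closure of smooth functions under algebraic operations\<close>

lemma Ck_on_const: "open W \<Longrightarrow> Ck_on k W (\<lambda>z. c)"
  by (induction k arbitrary: c) (auto intro: Ck_on_SucI[where D="\<lambda>u z. 0"])

lemma Ck_on_bounded_linear:
  assumes "open W" "bounded_linear L" "Ck_on k W f"
  shows "Ck_on k W (\<lambda>z. L (f z))"
  using assms(3)
proof (induction k arbitrary: f)
  case 0
  then show ?case using assms(2) by (auto intro: bounded_linear.continuous_on)
next
  case (Suc k)
  show ?case
    by (rule Ck_on_SucI[OF assms(1) bounded_linear.has_derivative[OF assms(2) Ck_on_has_derivative[OF Suc.prems]]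
          Suc.IH[OF Ck_on_dd[OF Suc.prems]]])
qed

lemma Ck_on_add:
  assumes "open W" "Ck_on k W f" "Ck_on k W g"
  shows "Ck_on k W (\<lambda>z. f z + g z)"
  using assms(2,3)
proof (induction k arbitrary: f g)
  case 0
  then show ?case by (auto intro: continuous_on_add)
next
  case (Suc k)
  show ?case
    by (rule Ck_on_SucI[OF assms(1) has_derivative_add[OF Ck_on_has_derivative[OF Suc.prems(1)]
            Ck_on_has_derivative[OF Suc.prems(2)]] Suc.IH[OF Ck_on_dd[OF Suc.prems(1)] Ck_on_dd[OF Suc.prems(2)]]])
qed

text \<open>Each term of the product rule keeps one undifferentiated factor;
  \<open>Ck_on_Suc_imp\<close> lowers the order of that factor so that the induction hypothesis
  applies.\<close>

lemma Ck_on_bilinear: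
  assumes "open W" "bounded_bilinear b" "Ck_on k W f" "Ck_on k W g"
  shows "Ck_on k W (\<lambda>z. b (f z) (g z))"
  using assms(3,4)
proof (induction k arbitrary: f g)
  case 0
  then show ?case using assms(2) by (auto intro: bounded_bilinear.continuous_on)
next
  case (Suc k)
  note f = Suc.prems(1) and g = Suc.prems(2)
  show ?case
    by (rule Ck_on_SucI[OF assms(1) bounded_bilinear.FDERIV[OF assms(2) Ck_on_has_derivative[OF f] Ck_on_has_derivative[OF g]]
          Ck_on_add[OF assms(1) Suc.IH[OF Ck_on_Suc_imp[OF f] Ck_on_dd[OF g]] Suc.IH[OF Ck_on_dd[OF f] Ck_on_Suc_imp[OF g]]]])
qed

text \<open>The derivative of 1/f is built from 1/f and the derivative of f, so the induction
  hypothesis for the same \<open>f\<close> controls it.\<close>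

lemma Ck_on_inverse:
  fixes f :: "'a::real_normed_vector \<Rightarrow> real"
  assumes "open W" "\<And>z. z \<in> W \<Longrightarrow> f z \<noteq> 0" "Ck_on k W f"
  shows "Ck_on k W (\<lambda>z. inverse (f z))"
  using assms(3)
proof (induction k)
  case 0
  then show ?case using assms(2) by (auto intro: continuous_on_inverse)
next
  case (Suc k)
  have "Ck_on k W (\<lambda>z. inverse (f z))" by (rule Suc.IH[OF Ck_on_Suc_imp[OF Suc.prems]])
  then have c: "Ck_on k W (\<lambda>z. - (inverse (f z) * dd u f z * inverse (f z)))" for u
    by (intro Ck_on_bounded_linear[OF assms(1) bounded_linear_minus[OF bounded_linear_ident]]
        Ck_on_bilinear[OF assms(1) bounded_bilinear_mult] Ck_on_dd[OF Suc.prems])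
  show ?case
    by (rule Ck_on_SucI[OF assms(1) Deriv.has_derivative_inverse[OF assms(2) Ck_on_has_derivative[OF Suc.prems]] c])
qed

lemma smooth_on_const: "open W \<Longrightarrow> smooth_on W (\<lambda>z. c)"
  by (simp add: smooth_on_def Ck_on_const)

lemma smooth_on_bounded_linear:
  "open W \<Longrightarrow> bounded_linear L \<Longrightarrow> smooth_on W f \<Longrightarrow> smooth_on W (\<lambda>z. L (f z))"
  by (simp add: smooth_on_def Ck_on_bounded_linear)

lemma smooth_on_add:
  "open W \<Longrightarrow> smooth_on W f \<Longrightarrow> smooth_on W g \<Longrightarrow> smooth_on W (\<lambda>z. f z + g z)"
  by (simp add: smooth_on_def Ck_on_add)

lemma smooth_on_scaleR:
  "open W \<Longrightarrow> smooth_on W f \<Longrightarrow> smooth_on W g \<Longrightarrow> smooth_on W (\<lambda>z. f z *\<^sub>R g z)"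
  by (simp add: smooth_on_def Ck_on_bilinear[OF _ bounded_bilinear_scaleR])

lemma smooth_on_mult:
  fixes f g :: "'a::real_normed_vector \<Rightarrow> real"
  shows "open W \<Longrightarrow> smooth_on W f \<Longrightarrow> smooth_on W g \<Longrightarrow> smooth_on W (\<lambda>z. f z * g z)"
  by (simp add: smooth_on_def Ck_on_bilinear[OF _ bounded_bilinear_mult])

lemma smooth_on_diff:
  assumes "open W" "smooth_on W f" "smooth_on W g"
  shows "smooth_on W (\<lambda>z. f z - g z)"
  using smooth_on_add[OF assms(1,2) smooth_on_bounded_linear[OF assms(1) bounded_linear_minus[OF bounded_linear_ident] assms(3)]]
  by simp

lemma smooth_on_power:
  fixes f :: "'a::real_normed_vector \<Rightarrow> real"
  assumes "open W" "smooth_on W f"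
  shows "smooth_on W (\<lambda>z. f z ^ k)"
  by (induction k) (auto intro: assms smooth_on_const smooth_on_mult)

lemma smooth_on_divide:
  fixes f g :: "'a::real_normed_vector \<Rightarrow> real"
  assumes "open W" "smooth_on W f" "smooth_on W g" "\<And>z. z \<in> W \<Longrightarrow> g z \<noteq> 0"
  shows "smooth_on W (\<lambda>z. f z / g z)"
  unfolding divide_inverse
  by (rule smooth_on_mult[OF assms(1,2)]) (use assms in \<open>simp add: smooth_on_def Ck_on_inverse\<close>)

lemma smooth_on_sum:
  assumes "open W" "\<And>i. i \<in> I \<Longrightarrow> smooth_on W (f i)"
  shows "smooth_on W (\<lambda>z. \<Sum>i\<in>I. f i z)"
  using assms(2) by (induction I rule: infinite_finite_induct) (auto intro: assms(1) smooth_on_add smooth_on_const)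

lemma smooth_on_linear:
  assumes "open W" "bounded_linear L"
  shows "smooth_on W L"
proof -
  have "Ck_on k W L" for k
  proof (cases k)
    case 0
    then show ?thesis using assms by (simp add: linear_continuous_on)
  next
    case (Suc m)
    show ?thesis unfolding Suc
      by (rule Ck_on_SucI[OF assms(1) bounded_linear_imp_has_derivative[OF assms(2)] Ck_on_const[OF assms(1)]])
  qed
  then show ?thesis by (simp add: smooth_on_def)
qed

section \<open>Derivatives along varying directions\<close>

lemma dd_linear: "f differentiable (at z) \<Longrightarrow> linear (\<lambda>u. dd u f z)"
  unfolding dd_def using linear_frechet_derivative by blast

lemma dd_expand:
  fixes f :: "'a::euclidean_space \<Rightarrow> 'b::real_normed_vector"
  assumes "f differentiable (at z)"
  shows "dd u f z = (\<Sum>i\<in>Basis. (u \<bullet> i) *\<^sub>R dd i f z)"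
proof -
  have "dd (\<Sum>i\<in>Basis. (u \<bullet> i) *\<^sub>R i) f z = (\<Sum>i\<in>Basis. (u \<bullet> i) *\<^sub>R dd i f z)"
    by (simp only: linear_sum[OF dd_linear[OF assms]] linear_scale[OF dd_linear[OF assms]])
  then show ?thesis by (simp only: euclidean_representation)
qed

text \<open>Smoothness is defined through fixed directions; expanding \<open>X z\<close> in a basis
  reduces to these, which is where finite dimension enters.\<close>

lemma smooth_on_field:
  fixes f :: "'a::euclidean_space \<Rightarrow> 'b::real_normed_vector"
  assumes "open W" "smooth_on W f" "smooth_on W X"
  shows "smooth_on W (\<lambda>z. dd (X z) f z)"
proof -
  have "smooth_on W (\<lambda>z. \<Sum>i\<in>Basis. (X z \<bullet> i) *\<^sub>R dd i f z)"
    using assms by (intro smooth_on_sum smooth_on_scaleR smooth_on_dd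
        smooth_on_bounded_linear[OF _ bounded_linear_inner_left])
  moreover have "dd (X z) f z = (\<Sum>i\<in>Basis. (X z \<bullet> i) *\<^sub>R dd i f z)" if "z \<in> W" for z
    by (intro dd_expand smooth_on_differentiable[OF assms(2) that])
  ultimately show ?thesis using smooth_on_cong[OF assms(1)] by (metis (no_types, lifting))
qed

section \<open>Symmetry of second derivatives\<close>

lemma mvt_line:
  fixes f :: "'a::real_normed_vector \<Rightarrow> real"
  assumes "0 < t" "\<And>r. r \<in> {0..t} \<Longrightarrow> f differentiable (at (z + r *\<^sub>R u))"
  shows "\<exists>r\<in>{0<..<t}. f (z + t *\<^sub>R u) - f z = t * dd u f (z + r *\<^sub>R u)"
proof -
  have d: "((\<lambda>r. f (z + r *\<^sub>R u)) has_derivative (\<lambda>h. h * dd u f (z + r *\<^sub>R u))) (at r)"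
    if "r \<in> {0..t}" for r
  proof -
    have "((\<lambda>r. z + r *\<^sub>R u) has_derivative (\<lambda>h. h *\<^sub>R u)) (at r)"
      by (auto intro!: derivative_eq_intros)
    from has_derivative_compose[OF this has_derivative_dd[OF assms(2)[OF that]]]
    have "((\<lambda>r. f (z + r *\<^sub>R u)) has_derivative (\<lambda>h. dd (h *\<^sub>R u) f (z + r *\<^sub>R u))) (at r)" .
    then show ?thesis by (simp add: linear_scale[OF dd_linear[OF assms(2)[OF that]]])
  qed
  have "\<exists>r\<in>{0<..<t}. f (z + t *\<^sub>R u) - f (z + 0 *\<^sub>R u) = (t - 0) * dd u f (z + r *\<^sub>R u)"
    by (rule mvt_simple[OF assms(1)]) (rule has_derivative_at_withinI, rule d, simp)
  then show ?thesis by simp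
qed

text \<open>The mean value theorem is used twice: along \<open>u\<close> for the difference
  \<open>\<phi>\<close> in direction \<open>w\<close>, then along \<open>w\<close> for
  \<open>dd u f\<close>. The bound on \<open>t\<close> keeps the whole parallelogram in the
  ball.\<close>

lemma second_difference_mvt:
  fixes f :: "'a::real_normed_vector \<Rightarrow> real"
  assumes f: "smooth_on W f" and d: "ball z d \<subseteq> W" and t: "0 < t" "t * (norm u + norm w) < d"
  shows "\<exists>\<xi>\<in>ball z d. f (z + t *\<^sub>R u + t *\<^sub>R w) - f (z + t *\<^sub>R u) - f (z + t *\<^sub>R w) + f z
      = t * t * dd w (dd u f) \<xi>"
proof -
  have in_ball: "z + r *\<^sub>R u + q *\<^sub>R w \<in> ball z d" if "r \<in> {0..t}" "q \<in> {0..t}" for r q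
  proof -
    have "norm (r *\<^sub>R u + q *\<^sub>R w) \<le> r * norm u + q * norm w"
      using norm_triangle_ineq[of "r *\<^sub>R u" "q *\<^sub>R w"] that by simp
    also have "\<dots> \<le> t * norm u + t * norm w"
      using that by (intro add_mono mult_right_mono) auto
    also have "\<dots> = t * (norm u + norm w)" by (simp only: distrib_left)
    finally have "norm (r *\<^sub>R u + q *\<^sub>R w) < d" using t(2) by simp
    then show ?thesis by (metis add.assoc add_diff_cancel_left' dist_commute dist_norm mem_ball)
  qed
  have f_diff: "f differentiable (at x)" "dd u f differentiable (at x)" if "x \<in> ball z d" for x
    using that d smooth_on_differentiable[OF f] smooth_on_differentiable[OF smooth_on_dd[OF f]] by auto
  define \<phi> where "\<phi> x = f (x + t *\<^sub>R w) - f x" for x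
  have \<phi>: "(\<phi> has_derivative (\<lambda>v. dd v f (z + r *\<^sub>R u + t *\<^sub>R w) - dd v f (z + r *\<^sub>R u))) (at (z + r *\<^sub>R u))"
    if "r \<in> {0..t}" for r
  proof -
    have "((\<lambda>x. f (x + t *\<^sub>R w)) has_derivative (\<lambda>v. dd v f (z + r *\<^sub>R u + t *\<^sub>R w))) (at (z + r *\<^sub>R u))"
      by (rule has_derivative_compose[of "\<lambda>x. x + t *\<^sub>R w" "\<lambda>v. v", where g=f])
        (use in_ball[OF that, of t] t in \<open>auto intro!: derivative_eq_intros has_derivative_dd f_diff\<close>)
    then show ?thesis unfolding \<phi>_def[abs_def]
      by (rule has_derivative_diff) (use in_ball[OF that, of 0] t in \<open>auto intro!: has_derivative_dd f_diff(1)\<close>)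
  qed
  have "\<phi> differentiable (at (z + r *\<^sub>R u))" if "r \<in> {0..t}" for r
    using differentiableI[OF \<phi>[OF that]] .
  then obtain r where r: "r \<in> {0<..<t}" "\<phi> (z + t *\<^sub>R u) - \<phi> z = t * dd u \<phi> (z + r *\<^sub>R u)"
    using mvt_line[OF t(1), of \<phi> z u] by blast
  have "dd u \<phi> (z + r *\<^sub>R u) = dd u f (z + r *\<^sub>R u + t *\<^sub>R w) - dd u f (z + r *\<^sub>R u)"
    using dd_eqI[OF \<phi>[of r]] r by auto
  then have r': "\<phi> (z + t *\<^sub>R u) - \<phi> z = t * (dd u f (z + r *\<^sub>R u + t *\<^sub>R w) - dd u f (z + r *\<^sub>R u))"
    using r(2) by simp
  have "dd u f differentiable (at (z + r *\<^sub>R u + q *\<^sub>R w))" if "q \<in> {0..t}" for q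
    using f_diff(2)[OF in_ball[of r q]] r(1) that by simp
  then obtain q where q: "q \<in> {0<..<t}"
    "dd u f (z + r *\<^sub>R u + t *\<^sub>R w) - dd u f (z + r *\<^sub>R u) = t * dd w (dd u f) (z + r *\<^sub>R u + q *\<^sub>R w)"
    using mvt_line[OF t(1), of "dd u f" "z + r *\<^sub>R u" w] by blast
  have "f (z + t *\<^sub>R u + t *\<^sub>R w) - f (z + t *\<^sub>R u) - f (z + t *\<^sub>R w) + f z = \<phi> (z + t *\<^sub>R u) - \<phi> z"
    by (simp add: \<phi>_def)
  also have "\<dots> = t * t * dd w (dd u f) (z + r *\<^sub>R u + q *\<^sub>R w)"
    unfolding r' q(2) by simp
  finally show ?thesis using in_ball[of r q] r(1) q(1) by auto
qed

text \<open>The second difference is symmetric in \<open>u\<close> and \<open>w\<close>, so the two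
  mixed derivatives take a common value at suitable points near \<open>z\<close>. Continuity then
  excludes a gap \<open>2 * e\<close> between them at \<open>z\<close>.\<close>

lemma dd_commute_real:
  fixes f :: "'a::real_normed_vector \<Rightarrow> real"
  assumes "open W" "smooth_on W f" "z \<in> W"
  shows "dd w (dd u f) z = dd u (dd w f) z"
proof (rule ccontr)
  define A where "A = dd w (dd u f)"
  define B where "B = dd u (dd w f)"
  define e where "e = \<bar>A z - B z\<bar> / 2"
  assume "dd w (dd u f) z \<noteq> dd u (dd w f) z"
  then have e: "0 < e" by (simp add: e_def A_def B_def)
  have "continuous (at z) A" "continuous (at z) B"
    using smooth_on_differentiable[OF smooth_on_dd[OF smooth_on_dd[OF assms(2)]] assms(3)]
    by (auto simp: A_def B_def intro: differentiable_imp_continuous_within)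
  then have ev: "\<forall>\<^sub>F x in nhds z. dist (A x) (A z) < e \<and> dist (B x) (B z) < e"
    using e by (intro eventually_conj) (auto simp: continuous_at_eps_delta eventually_nhds_metric)
  obtain d1 where d1: "0 < d1" "\<And>x. dist x z < d1 \<Longrightarrow> dist (A x) (A z) < e \<and> dist (B x) (B z) < e"
    using ev unfolding eventually_nhds_metric by blast
  obtain d3 where d3: "0 < d3" "ball z d3 \<subseteq> W" using assms open_contains_ball by blast
  define d where "d = min d1 d3"
  define m where "m = norm u + norm w"
  \<comment> \<open>The summand \<open>1\<close> keeps the denominator positive even if both
    directions vanish.\<close>
  define t where "t = d / (2 * (m + 1))"
  have d: "0 < d" "ball z d \<subseteq> W" using d1 d3 by (auto simp: d_def)
  have m: "0 \<le> m" by (simp add: m_def)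
  have t: "0 < t" using d m by (simp add: t_def)
  have "t * m < t * (2 * (m + 1))" using t m by (intro mult_strict_left_mono) auto
  also have "\<dots> = d" using m by (simp add: t_def)
  finally have td: "t * (norm u + norm w) < d" by (simp add: m_def)
  then have td': "t * (norm w + norm u) < d" by (simp only: add.commute)
  obtain \<xi> where xi: "\<xi> \<in> ball z d" "f (z + t *\<^sub>R u + t *\<^sub>R w) - f (z + t *\<^sub>R u) - f (z + t *\<^sub>R w) + f z
      = t * t * A \<xi>"
    unfolding A_def using second_difference_mvt[OF assms(2) d(2) t td] by blast
  obtain \<eta> where eta: "\<eta> \<in> ball z d" "f (z + t *\<^sub>R w + t *\<^sub>R u) - f (z + t *\<^sub>R w) - f (z + t *\<^sub>R u) + f z
      = t * t * B \<eta>"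
    unfolding B_def using second_difference_mvt[OF assms(2) d(2) t td'] by blast
  have "z + t *\<^sub>R w + t *\<^sub>R u = z + t *\<^sub>R u + t *\<^sub>R w" by simp
  then have "t * t * A \<xi> = t * t * B \<eta>" using xi(2) eta(2) by (simp only:)
  then have "A \<xi> = B \<eta>" using t by simp
  moreover have "dist (A \<xi>) (A z) < e" "dist (B \<eta>) (B z) < e"
    using d1(2)[of \<xi>] d1(2)[of \<eta>] xi(1) eta(1) by (auto simp: d_def dist_commute)
  ultimately have "\<bar>A z - B z\<bar> < 2 * e" by (auto simp: dist_real_def)
  then show False by (simp add: e_def)
qed

text \<open>Pairing with an arbitrary vector reduces the claim to real-valued functions.\<close>

lemma dd_commute:
  fixes f :: "'a::real_normed_vector \<Rightarrow> 'b::real_inner"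
  assumes "open W" "smooth_on W f" "z \<in> W"
  shows "dd w (dd u f) z = dd u (dd w f) z"
proof (rule vector_eq_rdot[THEN iffD1], rule allI)
  have ip: "dd v (\<lambda>x. g x \<bullet> b) x = dd v g x \<bullet> b" if "smooth_on W g" "x \<in> W" for v g x and b :: 'b
    by (rule dd_eqI) (intro bounded_linear.has_derivative[OF bounded_linear_inner_left] smooth_on_has_derivative[OF that])
  have ip2: "dd v (dd v' f) z \<bullet> b = dd v (dd v' (\<lambda>x. f x \<bullet> b)) z" for v v' b
  proof -
    have "dd v (dd v' f) z \<bullet> b = dd v (\<lambda>x. dd v' f x \<bullet> b) z"
      using ip[OF smooth_on_dd[OF assms(2)] assms(3)] by simp
    also have "\<dots> = dd v (dd v' (\<lambda>x. f x \<bullet> b)) z"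
      by (intro dd_cong[OF assms(1,3)]) (simp add: ip[OF assms(2)])
    finally show ?thesis .
  qed
  show "dd w (dd u f) z \<bullet> b = dd u (dd w f) z \<bullet> b" for b
    using dd_commute_real[OF assms(1) smooth_on_bounded_linear[OF assms(1) bounded_linear_inner_left assms(2)] assms(3)]
    by (simp only: ip2)
qed

lemma has_derivative_field:
  fixes f :: "'a::euclidean_space \<Rightarrow> 'b::real_inner"
  assumes "open W" "smooth_on W f" "z \<in> W" and X: "(X has_derivative X') (at z)"
  shows "((\<lambda>z. dd (X z) f z) has_derivative (\<lambda>u. dd (X z) (dd u f) z + dd (X' u) f z)) (at z)"
proof -
  note sd = smooth_on_differentiable[OF _ assms(3)]
  have "((\<lambda>z. \<Sum>i\<in>Basis. (X z \<bullet> i) *\<^sub>R dd i f z) has_derivative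
      (\<lambda>u. \<Sum>i\<in>Basis. (X z \<bullet> i) *\<^sub>R dd u (dd i f) z + (X' u \<bullet> i) *\<^sub>R dd i f z)) (at z)"
    by (intro has_derivative_sum has_derivative_scaleR smooth_on_has_derivative[OF _ assms(3)] smooth_on_dd assms(2)
        bounded_linear.has_derivative[OF bounded_linear_inner_left X])
  moreover have "(\<Sum>i\<in>Basis. (X z \<bullet> i) *\<^sub>R dd u (dd i f) z + (X' u \<bullet> i) *\<^sub>R dd i f z) =
      dd (X z) (dd u f) z + dd (X' u) f z" for u
    unfolding dd_expand[OF sd[OF smooth_on_dd[OF assms(2)]], of "X z" u] dd_expand[OF sd[OF assms(2)], of "X' u"]
      sum.distrib[symmetric] by (rule sum.cong[OF refl]) (simp only: dd_commute[OF assms(1-3), of u])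
  ultimately have "((\<lambda>z. \<Sum>i\<in>Basis. (X z \<bullet> i) *\<^sub>R dd i f z) has_derivative
      (\<lambda>u. dd (X z) (dd u f) z + dd (X' u) f z)) (at z)" by simp
  then show ?thesis
    by (rule has_derivative_transform_within_open[OF _ assms(1,3)])
      (rule dd_expand[OF smooth_on_differentiable[OF assms(2)], symmetric])
qed

lemma dd_field:
  fixes f :: "'a::euclidean_space \<Rightarrow> 'b::real_inner"
  assumes "open W" "smooth_on W f" "z \<in> W" and X: "(X has_derivative X') (at z)"
  shows "dd u (\<lambda>z. dd (X z) f z) z = dd (X z) (dd u f) z + dd (X' u) f z"
  using dd_eqI[OF has_derivative_field[OF assms]] .

section \<open>Sprays in coordinates\<close>

definition spray_deriv :: "('e \<times> 'e \<Rightarrow> 'e::real_normed_vector) \<Rightarrow> ('e \<times> 'e \<Rightarrow> 'b::real_normed_vector) \<Rightarrow> 'e \<times> 'e \<Rightarrow> 'b" where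
  "spray_deriv s f z = dd (snd z, s z) f z"

text \<open>Differentiation along the horizontal lift \<open>(a, - N a)\<close> of \<open>a\<close>,
  with the nonlinear connection \<open>N a = - dd (0, a) s / 2\<close>.\<close>

definition hor_deriv :: "('e \<times> 'e \<Rightarrow> 'e::real_normed_vector) \<Rightarrow> 'e \<Rightarrow> ('e \<times> 'e \<Rightarrow> 'b::real_normed_vector) \<Rightarrow> 'e \<times> 'e \<Rightarrow> 'b" where
  "hor_deriv s a f z = dd (a, (1/2) *\<^sub>R dd (0, a) s z) f z"

text \<open>With \<open>s = -2G\<close> and \<open>N a = - dd (0, a) s / 2\<close> this is the usual \<open>2 G\<^sub>x a - S(N a) - N (N a)\<close>.\<close>

definition curv :: "('e \<times> 'e \<Rightarrow> 'e::real_normed_vector) \<Rightarrow> 'e \<Rightarrow> 'e \<times> 'e \<Rightarrow> 'e" where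
  "curv s a z = (1/2) *\<^sub>R spray_deriv s (dd (0, a) s) z - dd (a, 0) s z
     - (1/4) *\<^sub>R dd (0, dd (0, a) s z) s z"

text \<open>Fibre homogeneity of degree \<open>k\<close> in the form of Euler's relation, which is
  local and can be differentiated directly.\<close>

definition homog :: "('e::real_normed_vector \<times> 'e) set \<Rightarrow> real \<Rightarrow> ('e \<times> 'e \<Rightarrow> 'b::real_normed_vector) \<Rightarrow> bool" where
  "homog W k f \<longleftrightarrow> (\<forall>z\<in>W. dd (0, snd z) f z = k *\<^sub>R f z)"

section \<open>Linearity in the direction and Euler's relation\<close>

lemma smooth_on_snd: "open W \<Longrightarrow> smooth_on W snd"
  by (rule smooth_on_linear[OF _ bounded_linear_snd])

lemma smooth_on_Pair:
  assumes "open W" "smooth_on W f" "smooth_on W g"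
  shows "smooth_on W (\<lambda>z. (f z, g z))"
proof -
  have "bounded_linear (\<lambda>x. (x, 0))" "bounded_linear (\<lambda>x. (0, x))"
    by (auto intro!: bounded_linear_Pair)
  from smooth_on_add[OF assms(1) smooth_on_bounded_linear[OF assms(1) this(1) assms(2)]
      smooth_on_bounded_linear[OF assms(1) this(2) assms(3)]]
  show ?thesis by simp
qed

lemma dd_Pair:
  fixes f :: "'e::real_normed_vector \<times> 'e \<Rightarrow> 'b::real_normed_vector"
  assumes "smooth_on W f" "z \<in> W"
  shows "dd (a, b) f z = dd (a, 0) f z + dd (0, b) f z"
proof -
  have "(a, b) = (a, 0) + (0, b)" by simp
  then show ?thesis using linear_add[OF dd_linear[OF smooth_on_differentiable[OF assms]]] by metis
qed

lemma dd_lin: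
  fixes f :: "'a::real_normed_vector \<Rightarrow> 'b::real_normed_vector"
  assumes "smooth_on W f" "z \<in> W"
  shows "dd (u + v) f z = dd u f z + dd v f z"
    and "dd (u - v) f z = dd u f z - dd v f z"
    and "dd (r *\<^sub>R u) f z = r *\<^sub>R dd u f z"
    and "dd (- u) f z = - dd u f z"
    and "dd 0 f z = 0"
proof -
  have lin: "linear (\<lambda>u. dd u f z)"
    by (rule dd_linear[OF smooth_on_differentiable[OF assms]])
  show "dd (u + v) f z = dd u f z + dd v f z"
    "dd (u - v) f z = dd u f z - dd v f z"
    "dd (r *\<^sub>R u) f z = r *\<^sub>R dd u f z"
    "dd (- u) f z = - dd u f z"
    "dd 0 f z = 0"
    using linear_add[OF lin] linear_diff[OF lin] linear_scale[OF lin] linear_neg[OF lin] linear_0[OF lin] by auto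
qed

text \<open>A sum inside a component is not syntactically a sum of pairs, so linearity is restated
  as rewrite rules for base directions and, below, for vertical ones.\<close>

lemma dd_lin_fst:
  fixes f :: "'e::real_normed_vector \<times> 'e \<Rightarrow> 'b::real_normed_vector"
  assumes "smooth_on W f" "z \<in> W"
  shows "dd (u + v, 0) f z = dd (u, 0) f z + dd (v, 0) f z"
    and "dd (u - v, 0) f z = dd (u, 0) f z - dd (v, 0) f z"
    and "dd (r *\<^sub>R u, 0) f z = r *\<^sub>R dd (u, 0) f z"
    and "dd (- u, 0) f z = - dd (u, 0) f z"
    and "dd (0, 0) f z = 0"
proof -
  have lin: "linear (\<lambda>u. dd (u, 0) f z)"
    using linear_compose[OF _ dd_linear[OF smooth_on_differentiable[OF assms]], of "\<lambda>u. (u, 0)"]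
    by (simp add: o_def linear_iff)
  show "dd (u + v, 0) f z = dd (u, 0) f z + dd (v, 0) f z"
    "dd (u - v, 0) f z = dd (u, 0) f z - dd (v, 0) f z"
    "dd (r *\<^sub>R u, 0) f z = r *\<^sub>R dd (u, 0) f z"
    "dd (- u, 0) f z = - dd (u, 0) f z"
    "dd (0, 0) f z = 0"
    using linear_add[OF lin] linear_diff[OF lin] linear_scale[OF lin] linear_neg[OF lin] linear_0[OF lin] by auto
qed

lemma dd_lin_snd:
  fixes f :: "'e::real_normed_vector \<times> 'e \<Rightarrow> 'b::real_normed_vector"
  assumes "smooth_on W f" "z \<in> W"
  shows "dd (0, u + v) f z = dd (0, u) f z + dd (0, v) f z"
    and "dd (0, u - v) f z = dd (0, u) f z - dd (0, v) f z"
    and "dd (0, r *\<^sub>R u) f z = r *\<^sub>R dd (0, u) f z"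
    and "dd (0, - u) f z = - dd (0, u) f z"
    and "dd (0, 0) f z = 0"
proof -
  have lin: "linear (\<lambda>u. dd (0, u) f z)"
    using linear_compose[OF _ dd_linear[OF smooth_on_differentiable[OF assms]], of "\<lambda>u. (0, u)"]
    by (simp add: o_def linear_iff)
  show "dd (0, u + v) f z = dd (0, u) f z + dd (0, v) f z"
    "dd (0, u - v) f z = dd (0, u) f z - dd (0, v) f z"
    "dd (0, r *\<^sub>R u) f z = r *\<^sub>R dd (0, u) f z"
    "dd (0, - u) f z = - dd (0, u) f z"
    "dd (0, 0) f z = 0"
    using linear_add[OF lin] linear_diff[OF lin] linear_scale[OF lin] linear_neg[OF lin] linear_0[OF lin] by auto
qed

text \<open>Differentiate Euler's relation along \<open>u\<close>. The radial direction varies with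
  the point, which produces the subtracted term: vertical derivatives lose one degree, base
  derivatives keep it.\<close>

lemma homog_dd:
  fixes f :: "'e::euclidean_space \<times> 'e \<Rightarrow> 'b::real_inner"
  assumes "open W" "smooth_on W f" "homog W k f" "z \<in> W"
  shows "dd (0, snd z) (dd u f) z = k *\<^sub>R dd u f z - dd (0, snd u) f z"
proof -
  have "((\<lambda>z::'e \<times> 'e. (0::'e, snd z)) has_derivative (\<lambda>u. (0, snd u))) (at z)"
    by (auto intro!: derivative_eq_intros)
  from dd_field[OF assms(1,2,4) this]
  have "dd u (\<lambda>z. dd (0, snd z) f z) z = dd (0, snd z) (dd u f) z + dd (0, snd u) f z" .
  moreover have "dd u (\<lambda>z. dd (0, snd z) f z) z = dd u (\<lambda>z. k *\<^sub>R f z) z"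
    using assms(3) by (intro dd_cong[OF assms(1,4)]) (auto simp: homog_def)
  moreover have "dd u (\<lambda>z. k *\<^sub>R f z) z = k *\<^sub>R dd u f z"
    by (rule dd_eqI) (intro has_derivative_scaleR_right smooth_on_has_derivative[OF assms(2,4)])
  ultimately show ?thesis by simp
qed

text \<open>Degree \<open>2\<close> is what \<open>[C, S] = S\<close> says about the vertical
  component of \<open>S = (y, s)\<close>.\<close>

locale coord_spray =
  fixes W :: "('e::euclidean_space \<times> 'e) set" and s :: "'e \<times> 'e \<Rightarrow> 'e"
  assumes open_W: "open W" and smooth_s: "smooth_on W s" and homog_s: "homog W 2 s"
begin

lemma smooth_on_spray_deriv: "smooth_on W f \<Longrightarrow> smooth_on W (spray_deriv s f)"
  unfolding spray_deriv_def[abs_def]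
  by (intro smooth_on_field[OF open_W] smooth_on_Pair[OF open_W] smooth_on_snd[OF open_W] smooth_s)

lemma smooth_on_hor_deriv: "smooth_on W f \<Longrightarrow> smooth_on W (hor_deriv s a f)"
  unfolding hor_deriv_def[abs_def]
  by (intro smooth_on_field[OF open_W] smooth_on_Pair[OF open_W] smooth_on_const[OF open_W]
      smooth_on_scaleR[OF open_W] smooth_on_dd smooth_s)

text \<open>The extra term is the bracket of the constant field \<open>u\<close> with the
  spray.\<close>

lemma dd_spray_deriv:
  fixes f :: "'e \<times> 'e \<Rightarrow> 'b::real_inner"
  assumes "smooth_on W f" "z \<in> W"
  shows "dd u (spray_deriv s f) z = spray_deriv s (dd u f) z + dd (snd u, dd u s z) f z"
proof -
  have "((\<lambda>z. (snd z, s z)) has_derivative (\<lambda>u. (snd u, dd u s z))) (at z)"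
    by (intro has_derivative_Pair has_derivative_snd has_derivative_ident smooth_on_has_derivative[OF smooth_s assms(2)])
  from dd_field[OF open_W assms this] show ?thesis
    by (simp add: spray_deriv_def[abs_def])
qed

lemma dd_hor_deriv:
  fixes f :: "'e \<times> 'e \<Rightarrow> 'b::real_inner"
  assumes "smooth_on W f" "z \<in> W"
  shows "dd u (hor_deriv s a f) z = hor_deriv s a (dd u f) z + dd (0, (1/2) *\<^sub>R dd u (dd (0, a) s) z) f z"
proof -
  have "((\<lambda>z. (a, (1/2) *\<^sub>R dd (0, a) s z)) has_derivative (\<lambda>u. (0, (1/2) *\<^sub>R dd u (dd (0, a) s) z))) (at z)"
    by (intro has_derivative_Pair has_derivative_const has_derivative_scaleR_right
        smooth_on_has_derivative[OF smooth_on_dd[OF smooth_s] assms(2)])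
  from dd_field[OF open_W assms this] show ?thesis
    by (simp add: hor_deriv_def[abs_def])
qed

lemma hor_deriv_Pair:
  assumes "smooth_on W f" "z \<in> W"
  shows "hor_deriv s a f z = dd (a, 0) f z + (1/2) *\<^sub>R dd (0, dd (0, a) s z) f z"
  unfolding hor_deriv_def using dd_Pair[OF assms] dd_lin_snd[OF assms] by metis

text \<open>This is the geometric meaning of \<open>curv\<close>: it is the vertical part of the
  bracket of the spray with a horizontal lift. The second-order terms cancel by symmetry of second
  derivatives.\<close>

lemma spray_hor_commutator:
  fixes f :: "'e \<times> 'e \<Rightarrow> real"
  assumes f: "smooth_on W f" and z: "z \<in> W"
  shows "spray_deriv s (hor_deriv s a f) z - hor_deriv s a (spray_deriv s f) z =
    dd (0, curv s a z) f z - (1/2) * hor_deriv s (dd (0, a) s z) f z"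
proof -
  let ?Y = "(snd z, s z)" and ?X = "(a, (1/2) *\<^sub>R dd (0, a) s z)"
  have 1: "spray_deriv s (hor_deriv s a f) z = dd ?X (dd ?Y f) z + dd (0, (1/2) *\<^sub>R spray_deriv s (dd (0, a) s) z) f z"
    using dd_hor_deriv[OF f z, of ?Y a] by (simp add: spray_deriv_def hor_deriv_def)
  have 2: "hor_deriv s a (spray_deriv s f) z = dd ?Y (dd ?X f) z + dd ((1/2) *\<^sub>R dd (0, a) s z, dd ?X s z) f z"
    using dd_spray_deriv[OF f z, of ?X] by (simp add: spray_deriv_def hor_deriv_def)
  show ?thesis
    unfolding 1 2 dd_commute[OF open_W f z, of ?Y ?X] hor_deriv_Pair[OF f z] curv_def
      dd_Pair[OF f z, of "(1/2) *\<^sub>R dd (0, a) s z" "dd ?X s z"]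
    unfolding dd_Pair[OF smooth_s z, of a "(1/2) *\<^sub>R dd (0, a) s z"]
    by (simp add: dd_lin_snd[OF f z] dd_lin_fst[OF f z] dd_lin_snd[OF smooth_s z] algebra_simps)
qed

lemma homog_spray_deriv:
  fixes f :: "'e \<times> 'e \<Rightarrow> 'b::real_inner"
  assumes f: "smooth_on W f" and "homog W k f"
  shows "homog W (k + 1) (spray_deriv s f)"
  unfolding homog_def
proof
  fix z assume z: "z \<in> W"
  have "dd (0, snd z) (spray_deriv s f) z = dd (0, snd z) (dd (snd z, s z) f) z + dd (snd z, 2 *\<^sub>R s z) f z"
    using dd_spray_deriv[OF f z, of "(0, snd z)"] homog_s z
    by (simp add: spray_deriv_def homog_def dd_commute[OF open_W f z, of "(snd z, s z)"])
  also have "\<dots> = (k + 1) *\<^sub>R spray_deriv s f z"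
    unfolding homog_dd[OF open_W assms z] spray_deriv_def dd_Pair[OF f z, of "snd z" "s z"] dd_Pair[OF f z, of "snd z" "2 *\<^sub>R s z"]
    by (simp add: dd_lin_snd[OF f z] algebra_simps scaleR_2)
  finally show "dd (0, snd z) (spray_deriv s f) z = (k + 1) *\<^sub>R spray_deriv s f z" .
qed

text \<open>Euler's relation \<open>dd (0, y) s = 2 s\<close> makes the spray the horizontal lift of
  \<open>y\<close>.\<close>

lemma hor_deriv_canonical:
  assumes "z \<in> W"
  shows "hor_deriv s (snd z) f z = spray_deriv s f z"
  using homog_s assms unfolding hor_deriv_def spray_deriv_def by (simp add: homog_def)

text \<open>One direction contracts with \<open>b = y\<close>. For the other, the contracted
  identity is differentiated along \<open>(0, b)\<close> and antisymmetrised in \<open>a\<close> and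
  \<open>b\<close>; the terms with \<open>S\<close> cancel and twice the Hamel identity
  remains.\<close>

lemma hamel_iff:
  fixes P :: "'e \<times> 'e \<Rightarrow> real"
  assumes P: "smooth_on W P" and "homog W 1 P"
  shows "(\<forall>z\<in>W. \<forall>a b. hor_deriv s a (dd (0, b) P) z = hor_deriv s b (dd (0, a) P) z) \<longleftrightarrow>
    (\<forall>z\<in>W. \<forall>a. spray_deriv s (dd (0, a) P) z = dd (a, 0) P z)"
proof (intro iffI ballI allI)
  fix z a assume *: "\<forall>z\<in>W. \<forall>a b. hor_deriv s a (dd (0, b) P) z = hor_deriv s b (dd (0, a) P) z" and z: "z \<in> W"
  \<comment> \<open>The direction \<open>snd z\<close> is frozen here, so the hypothesis may be used
    with \<open>b = snd z\<close>.\<close>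
  have "spray_deriv s (dd (0, a) P) z = hor_deriv s a (dd (0, snd z) P) z"
    using * z by (simp add: hor_deriv_canonical[symmetric])
  also have "\<dots> = dd (0, snd z) (dd (a, (1/2) *\<^sub>R dd (0, a) s z) P) z"
    unfolding hor_deriv_def by (rule dd_commute[OF open_W P z])
  also have "\<dots> = dd (a, 0) P z"
    unfolding homog_dd[OF open_W assms z] by (simp add: dd_Pair[OF P z, of a "(1/2) *\<^sub>R dd (0, a) s z"])
  finally show "spray_deriv s (dd (0, a) P) z = dd (a, 0) P z" .
next
  fix z a b assume *: "\<forall>z\<in>W. \<forall>a. spray_deriv s (dd (0, a) P) z = dd (a, 0) P z" and z: "z \<in> W"
  have sm: "smooth_on W (dd u P)" for u using P by (rule smooth_on_dd)
  have "spray_deriv s (dd (0, b) (dd (0, a) P)) z + dd (b, dd (0, b) s z) (dd (0, a) P) z = dd (0, b) (dd (a, 0) P) z" for a b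
  proof -
    have "dd (0, b) (spray_deriv s (dd (0, a) P)) z = dd (0, b) (dd (a, 0) P) z"
      using * by (intro dd_cong[OF open_W z]) auto
    then show ?thesis using dd_spray_deriv[OF sm z, of "(0, b)" "(0, a)"] by simp
  qed
  note this[of a b] this[of b a]
  moreover have "spray_deriv s (dd (0, b) (dd (0, a) P)) z = spray_deriv s (dd (0, a) (dd (0, b) P)) z"
    unfolding spray_deriv_def by (intro dd_cong[OF open_W z] dd_commute[OF open_W P])
  ultimately show "hor_deriv s a (dd (0, b) P) z = hor_deriv s b (dd (0, a) P) z"
    unfolding hor_deriv_Pair[OF sm z] dd_Pair[OF sm z, of a "dd (0, a) s z"] dd_Pair[OF sm z, of b "dd (0, b) s z"]
      dd_commute[OF open_W P z, of "(0, _)" "(_, 0)"]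
    by simp
qed

text \<open>For \<open>a = y\<close> the Euler-Lagrange equation \<open>geo\<close> and homogeneity
  give \<open>S E = 0\<close>. The vertical derivative of this, with \<open>geo\<close> again, is
  twice \<open>H\<^sub>a E = 0\<close>.\<close>

lemma geodesic_energy:
  fixes E :: "'e \<times> 'e \<Rightarrow> real"
  assumes E: "smooth_on W E" and hE: "homog W 2 E"
    and geo: "\<And>z a. z \<in> W \<Longrightarrow> spray_deriv s (dd (0, a) E) z = dd (a, 0) E z"
    and z: "z \<in> W"
  shows "spray_deriv s E z = 0" and "hor_deriv s a E z = 0"
proof -
  have S0: "spray_deriv s E z = 0" if z: "z \<in> W" for z
  proof -
    have "dd (snd z, 0) E z = dd (0, snd z) (dd (snd z, s z) E) z"
      using geo[OF z, of "snd z"] by (simp add: spray_deriv_def dd_commute[OF open_W E z, of "(0, snd z)"])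
    then show ?thesis
      unfolding homog_dd[OF open_W E hE z] spray_deriv_def dd_Pair[OF E z, of "snd z" "s z"] by simp
  qed
  then show "spray_deriv s E z = 0" using z .
  have "dd (0, a) (spray_deriv s E) z = dd (0, a) (\<lambda>_. 0) z"
    by (intro dd_cong[OF open_W z] S0)
  also have "\<dots> = 0" by (rule dd_eqI) (rule has_derivative_const)
  finally show "hor_deriv s a E z = 0"
    unfolding dd_spray_deriv[OF E z] geo[OF z] hor_deriv_Pair[OF E z] by (simp add: dd_Pair[OF E z, of a "dd (0, a) s z"])
qed

text \<open>In the commutator of \<open>S\<close> and \<open>H\<^sub>a\<close> applied to
  \<open>E\<close>, every term but the one with the curvature vanishes.\<close>

lemma dd_curv_energy:
  fixes E :: "'e \<times> 'e \<Rightarrow> real"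
  assumes E: "smooth_on W E" and "\<And>z. z \<in> W \<Longrightarrow> spray_deriv s E z = 0"
    and "\<And>z a. z \<in> W \<Longrightarrow> hor_deriv s a E z = 0" and z: "z \<in> W"
  shows "dd (0, curv s a z) E z = 0"
proof -
  have 0: "dd u (\<lambda>_. 0) z = (0::real)" for u by (rule dd_eqI) (rule has_derivative_const)
  have "spray_deriv s (hor_deriv s a E) z = 0" "hor_deriv s a (spray_deriv s E) z = 0"
    unfolding spray_deriv_def[of s "hor_deriv s a E"] hor_deriv_def[of s a "spray_deriv s E"]
    using dd_cong[OF open_W z, of "hor_deriv s a E" "\<lambda>_. 0"] dd_cong[OF open_W z, of "spray_deriv s E" "\<lambda>_. 0"] assms 0
    by auto
  then show ?thesis using spray_hor_commutator[OF E z, of a] assms(3)[OF z] by simp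
qed

end

section \<open>Projective deformations in coordinates\<close>

locale projective_pair = base: coord_spray W s + deformed: coord_spray W s'
  for W :: "('e::euclidean_space \<times> 'e) set" and s s' :: "'e \<times> 'e \<Rightarrow> 'e" +
  fixes P :: "'e \<times> 'e \<Rightarrow> real"
  assumes smooth_P: "smooth_on W P" and homog_P: "homog W 1 P"
    and deformation: "\<And>z. z \<in> W \<Longrightarrow> s' z = s z - (2 * P z) *\<^sub>R snd z"
begin

lemmas open_W = base.open_W and smooth_s = base.smooth_s

lemma dd_deformed:
  assumes z: "z \<in> W"
  shows "dd u s' z = dd u s z - (2 * dd u P z) *\<^sub>R snd z - (2 * P z) *\<^sub>R snd u"
proof -
  have "dd u s' z = dd u (\<lambda>z. s z - (2 * P z) *\<^sub>R snd z) z"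
    by (intro dd_cong[OF open_W z] deformation)
  also have "\<dots> = dd u s z - (2 * dd u P z) *\<^sub>R snd z - (2 * P z) *\<^sub>R snd u"
    by (rule dd_eqI)
      (auto intro!: derivative_eq_intros smooth_on_has_derivative[OF smooth_s z] smooth_on_has_derivative[OF smooth_P z])
  finally show ?thesis .
qed

lemma dd_dd_deformed:
  assumes z: "z \<in> W"
  shows "dd u (dd (0, a) s') z = dd u (dd (0, a) s) z - (2 * dd u (dd (0, a) P) z) *\<^sub>R snd z
    - (2 * dd (0, a) P z) *\<^sub>R snd u - (2 * dd u P z) *\<^sub>R a"
proof -
  have "dd u (dd (0, a) s') z = dd u (\<lambda>z. dd (0, a) s z - (2 * dd (0, a) P z) *\<^sub>R snd z - (2 * P z) *\<^sub>R a) z"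
    by (intro dd_cong[OF open_W z]) (simp add: dd_deformed)
  also have "\<dots> = dd u (dd (0, a) s) z - (2 * dd u (dd (0, a) P) z) *\<^sub>R snd z
    - (2 * dd (0, a) P z) *\<^sub>R snd u - (2 * dd u P z) *\<^sub>R a"
    by (rule dd_eqI)
      (auto intro!: derivative_eq_intros smooth_on_has_derivative[OF smooth_on_dd[OF smooth_s] z]
        smooth_on_has_derivative[OF smooth_on_dd[OF smooth_P] z] smooth_on_has_derivative[OF smooth_P z])
  finally show ?thesis .
qed

lemma spray_deriv_deformed:
  assumes "smooth_on W f" "z \<in> W"
  shows "spray_deriv s' f z = spray_deriv s f z - (2 * P z) *\<^sub>R dd (0, snd z) f z"
proof -
  have "(snd z, s' z) = (snd z, s z) - (0, (2 * P z) *\<^sub>R snd z)" by (simp add: deformation[OF assms(2)])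
  then show ?thesis unfolding spray_deriv_def by (simp only: dd_lin[OF assms] dd_lin_snd[OF assms])
qed

lemma hor_deriv_deformed:
  assumes "smooth_on W f" "z \<in> W"
  shows "hor_deriv s' a f z = hor_deriv s a f z - dd (0, a) P z *\<^sub>R dd (0, snd z) f z - P z *\<^sub>R dd (0, a) f z"
  unfolding deformed.hor_deriv_Pair[OF assms] base.hor_deriv_Pair[OF assms]
  by (simp add: dd_deformed[OF assms(2)] dd_lin_snd[OF assms] algebra_simps)

text \<open>The coefficients of \<open>a\<close> and \<open>y\<close> are \<open>\<Xi>\<close> and
  \<open>\<tau>(a)\<close>. The three terms of \<open>curv\<close> are expanded separately in
  \<open>S\<close>, \<open>V\<close> and \<open>X\<close>.\<close>

lemma curv_deformed:
  assumes z: "z \<in> W"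
  shows "curv s' a z = curv s a z + ((P z)\<^sup>2 - spray_deriv s P z) *\<^sub>R a
    + (2 * dd (a, 0) P z + 1/2 * dd (0, dd (0, a) s z) P z - spray_deriv s (dd (0, a) P) z - P z * dd (0, a) P z) *\<^sub>R snd z"
proof -
  \<comment> \<open>Euler's relations evaluate the derivatives along \<open>y\<close> that the
    summand \<open>2 P y\<close> of the deformation produces.\<close>
  have C: "dd (0, snd z) (dd (0, a) s) z = dd (0, a) s z" "dd (0, snd z) (dd (0, a) P) z = 0" "dd (0, snd z) P z = P z"
    "dd (0, snd z) s z = 2 *\<^sub>R s z"
    using homog_dd[OF open_W smooth_s base.homog_s z, of "(0, a)"] homog_dd[OF open_W smooth_P homog_P z, of "(0, a)"]
      homog_P base.homog_s z by (auto simp: homog_def scaleR_2)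
  define w where "w = dd (0, a) s z"
  have w': "dd (0, a) s' z = w - (2 * dd (0, a) P z) *\<^sub>R snd z - (2 * P z) *\<^sub>R a"
    by (simp add: dd_deformed[OF z] w_def)
  have S: "spray_deriv s' (dd (0, a) s') z = spray_deriv s (dd (0, a) s) z - (2 * P z) *\<^sub>R w
      - (2 * spray_deriv s (dd (0, a) P) z) *\<^sub>R snd z - (2 * dd (0, a) P z) *\<^sub>R (s z - (2 * P z) *\<^sub>R snd z)
      - (2 * (spray_deriv s P z - 2 * P z * P z)) *\<^sub>R a"
  proof -
    have "spray_deriv s' (dd (0, a) s') z = spray_deriv s' (dd (0, a) s) z - (2 * spray_deriv s' (dd (0, a) P) z) *\<^sub>R snd z
      - (2 * dd (0, a) P z) *\<^sub>R s' z - (2 * spray_deriv s' P z) *\<^sub>R a"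
      unfolding spray_deriv_def by (simp add: dd_dd_deformed[OF z])
    then show ?thesis
      by (simp add: spray_deriv_deformed[OF smooth_on_dd[OF smooth_s] z] spray_deriv_deformed[OF smooth_on_dd[OF smooth_P] z]
          spray_deriv_deformed[OF smooth_P z] C deformation[OF z] w_def)
  qed
  have V: "dd (0, dd (0, a) s' z) s' z = dd (0, w) s z - (4 * dd (0, a) P z) *\<^sub>R s z - (2 * P z) *\<^sub>R w
      - (2 * (dd (0, w) P z - 4 * dd (0, a) P z * P z)) *\<^sub>R snd z
      - (2 * P z) *\<^sub>R (w - (2 * dd (0, a) P z) *\<^sub>R snd z - (2 * P z) *\<^sub>R a)"
    unfolding w' dd_deformed[OF z] dd_lin_snd[OF smooth_s z] dd_lin_snd[OF smooth_P z] C
    by (simp add: w_def[symmetric] algebra_simps)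
  have X: "dd (a, 0) s' z = dd (a, 0) s z - (2 * dd (a, 0) P z) *\<^sub>R snd z"
    by (simp add: dd_deformed[OF z])
  \<comment> \<open>Pairing with an arbitrary \<open>b\<close> turns the vector identity into a
    polynomial one between real numbers.\<close>
  have "curv s' a z \<bullet> b = (curv s a z + ((P z)\<^sup>2 - spray_deriv s P z) *\<^sub>R a
    + (2 * dd (a, 0) P z + 1/2 * dd (0, dd (0, a) s z) P z - spray_deriv s (dd (0, a) P) z - P z * dd (0, a) P z) *\<^sub>R snd z) \<bullet> b" for b
    unfolding curv_def S V X w_def[symmetric]
    by (simp add: inner_simps field_simps power2_eq_square)
  then show ?thesis using vector_eq_rdot by blast
qed

section \<open>Constant curvature and the Hamel condition in one chart\<close>

lemma smooth_SP: "smooth_on W (spray_deriv s P)"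
  by (rule base.smooth_on_spray_deriv[OF smooth_P])

text \<open>Comparing the coefficients of \<open>a\<close> and of \<open>y\<close> gives two linear
  relations between vertical derivatives; eliminating \<open>E\<close> and \<open>E'\<close> leaves
  the Hamel condition.\<close>

lemma hamel_of_isotropic_pair:
  fixes E E' :: "'e \<times> 'e \<Rightarrow> real"
  assumes E: "smooth_on W E" and E': "smooth_on W E'" and dim: "2 \<le> DIM('e)" and nz: "\<And>z. z \<in> W \<Longrightarrow> snd z \<noteq> 0"
    and R: "\<And>z a. z \<in> W \<Longrightarrow> curv s a z = k *\<^sub>R (E z *\<^sub>R a - (1/2 * dd (0, a) E z) *\<^sub>R snd z)"
    and R': "\<And>z a. z \<in> W \<Longrightarrow> curv s' a z = k' *\<^sub>R (E' z *\<^sub>R a - (1/2 * dd (0, a) E' z) *\<^sub>R snd z)"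
    and z: "z \<in> W"
  shows "spray_deriv s (dd (0, a) P) z = dd (a, 0) P z"
proof -
  define \<tau> where "\<tau> a z = 2 * dd (a, 0) P z + 1/2 * dd (0, dd (0, a) s z) P z - spray_deriv s (dd (0, a) P) z - P z * dd (0, a) P z" for a z
  define \<mu> where "\<mu> z = k * E z + (P z)\<^sup>2 - spray_deriv s P z - k' * E' z" for z
  have eq: "\<mu> z *\<^sub>R a = (k * (1/2 * dd (0, a) E z) - k' * (1/2 * dd (0, a) E' z) - \<tau> a z) *\<^sub>R snd z" if z: "z \<in> W" for z a
    using curv_deformed[OF z, of a, folded \<tau>_def] unfolding R[OF z] R'[OF z]
    by (simp add: \<mu>_def algebra_simps)
  have \<mu>0: "\<mu> z = 0" if z: "z \<in> W" for z
  proof -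
    \<comment> \<open>In dimension at least two some nonzero \<open>a\<close> is orthogonal to
      \<open>y\<close>; pairing with it isolates \<open>\<mu> z\<close>.\<close>
    obtain a where "a \<noteq> 0" "orthogonal (snd z) a" using orthogonal_to_vector_exists[OF dim] by metis
    then have "snd z \<bullet> a = 0" "a \<bullet> a \<noteq> 0" by (auto simp: orthogonal_def)
    moreover have "(\<mu> z *\<^sub>R a) \<bullet> a = 0" unfolding eq[OF z] by (simp add: \<open>snd z \<bullet> a = 0\<close>)
    ultimately show ?thesis by simp
  qed
  have "dd (0, a) \<mu> z = dd (0, a) (\<lambda>_. 0) z" by (intro dd_cong[OF open_W z] \<mu>0)
  also have "\<dots> = 0" by (rule dd_eqI) (rule has_derivative_const)
  finally have "dd (0, a) \<mu> z = 0" .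
  moreover have "dd (0, a) \<mu> z = k * dd (0, a) E z + 2 * P z * dd (0, a) P z - dd (0, a) (spray_deriv s P) z - k' * dd (0, a) E' z"
    unfolding \<mu>_def[abs_def]
    by (rule dd_eqI) (auto intro!: derivative_eq_intros smooth_on_has_derivative[OF E z] smooth_on_has_derivative[OF E' z]
        smooth_on_has_derivative[OF smooth_P z] smooth_on_has_derivative[OF smooth_SP z])
  moreover have "dd (0, a) (spray_deriv s P) z = spray_deriv s (dd (0, a) P) z + dd (a, 0) P z + dd (0, dd (0, a) s z) P z"
    by (simp add: base.dd_spray_deriv[OF smooth_P z] dd_Pair[OF smooth_P z, of a "dd (0, a) s z"])
  \<comment> \<open>With \<open>\<mu> = 0\<close> only the coefficient of \<open>y\<close> is left
    in \<open>eq\<close>, and \<open>y\<close> is nonzero.\<close>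
  moreover have "k * (1/2 * dd (0, a) E z) - k' * (1/2 * dd (0, a) E' z) - \<tau> a z = 0"
    using eq[OF z, of a] \<mu>0[OF z] nz[OF z] by simp
  ultimately show ?thesis unfolding \<tau>_def by (simp add: algebra_simps)
qed

text \<open>The only candidate for the curvature is the coefficient of \<open>a\<close> in the
  deformed curvature divided by \<open>E'\<close>. Its vertical derivative vanishes because
  \<open>E'\<close> is preserved by \<open>S'\<close>; its base derivative vanishes by the convexity
  of \<open>E'\<close>.\<close>

lemma hamel_curvature:
  fixes E E' :: "'e \<times> 'e \<Rightarrow> real"
  assumes E: "smooth_on W E" and hE: "homog W 2 E" and E': "smooth_on W E'" and hE': "homog W 2 E'"
    and dim: "2 \<le> DIM('e)"
    and HE: "\<And>z a. z \<in> W \<Longrightarrow> hor_deriv s a E z = 0"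
    and SE': "\<And>z. z \<in> W \<Longrightarrow> spray_deriv s' E' z = 0"
    and HE': "\<And>z a. z \<in> W \<Longrightarrow> hor_deriv s' a E' z = 0"
    and pos: "\<And>z. z \<in> W \<Longrightarrow> E' z > 0"
    and convex: "\<And>z a. z \<in> W \<Longrightarrow> a \<noteq> 0 \<Longrightarrow> dd (0, a) (dd (0, a) E') z > 0"
    and R: "\<And>z a. z \<in> W \<Longrightarrow> curv s a z = k *\<^sub>R (E z *\<^sub>R a - (1/2 * dd (0, a) E z) *\<^sub>R snd z)"
    and Q: "\<And>z a. z \<in> W \<Longrightarrow> spray_deriv s (dd (0, a) P) z = dd (a, 0) P z"
    and \<kappa>: "\<kappa> = (\<lambda>z. (k * E z + (P z)\<^sup>2 - spray_deriv s P z) / E' z)"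
    and z: "z \<in> W"
  shows "(\<kappa> has_derivative (\<lambda>_. 0)) (at z)"
    and "curv s' a z = \<kappa> z *\<^sub>R (E' z *\<^sub>R a - (1/2 * dd (0, a) E' z) *\<^sub>R snd z)"
proof -
  define SP where "SP = spray_deriv s P"
  define SSP where "SSP = spray_deriv s SP"
  define \<rho> where "\<rho> z = k * E z + (P z)\<^sup>2 - SP z" for z
  \<comment> \<open>This is \<open>S' \<rho>\<close> written out with \<open>S E = 0\<close>. The
    choice is forced: for \<open>a = y\<close> and degree \<open>3\<close>, the identity
    \<open>H\<rho>\<close> below says \<open>\<psi> = S' \<rho>\<close>.\<close>
  define \<psi> where "\<psi> z = 6 * P z * SP z - 4 * P z ^ 3 - SSP z - 4 * k * E z * P z" for z
  have \<kappa>: "\<kappa> = (\<lambda>z. \<rho> z / E' z)" by (simp add: \<kappa> \<rho>_def[abs_def] SP_def)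
  have sSP: "smooth_on W SP" unfolding SP_def by (rule smooth_SP)
  have sSSP: "smooth_on W SSP" unfolding SSP_def by (rule base.smooth_on_spray_deriv[OF sSP])
  have s\<rho>: "smooth_on W \<rho>" unfolding \<rho>_def[abs_def]
    by (intro smooth_on_diff smooth_on_add smooth_on_mult smooth_on_power smooth_on_const open_W E smooth_P sSP)
  have s\<psi>: "smooth_on W \<psi>" unfolding \<psi>_def[abs_def]
    by (intro smooth_on_diff smooth_on_add smooth_on_mult smooth_on_power smooth_on_const open_W E smooth_P sSP sSSP)
  have s\<kappa>: "smooth_on W \<kappa>" unfolding \<kappa>
    by (intro smooth_on_divide open_W s\<rho> E') (use pos in force)
  have d\<rho>: "dd u \<rho> z = k * dd u E z + 2 * P z * dd u P z - dd u SP z" if z: "z \<in> W" for u z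
    unfolding \<rho>_def[abs_def]
    by (rule dd_eqI) (auto intro!: derivative_eq_intros smooth_on_has_derivative[OF E z]
        smooth_on_has_derivative[OF smooth_P z] smooth_on_has_derivative[OF sSP z])
  have d\<psi>: "dd u \<psi> z = 6 * (dd u P z * SP z + P z * dd u SP z) - 12 * (P z)\<^sup>2 * dd u P z - dd u SSP z
      - 4 * k * (dd u E z * P z + E z * dd u P z)" if z: "z \<in> W" for u z
    unfolding \<psi>_def[abs_def]
    by (rule dd_eqI) (auto intro!: derivative_eq_intros smooth_on_has_derivative[OF E z]
        smooth_on_has_derivative[OF smooth_P z] smooth_on_has_derivative[OF sSP z] smooth_on_has_derivative[OF sSSP z]
        simp: algebra_simps power2_eq_square)
  have hSP: "homog W 2 SP" unfolding SP_def using base.homog_spray_deriv[OF smooth_P homog_P] by simp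
  have hSSP: "homog W 3 SSP" unfolding SSP_def using base.homog_spray_deriv[OF sSP hSP] by simp
  have h\<rho>: "dd (0, snd z) \<rho> z = 2 * \<rho> z" if "z \<in> W" for z
    using that hE hSP homog_P unfolding d\<rho>[OF that] by (simp add: homog_def \<rho>_def power2_eq_square algebra_simps)
  have h\<psi>: "dd (0, snd z) \<psi> z = 3 * \<psi> z" if "z \<in> W" for z
    using that hE hSP hSSP homog_P unfolding d\<psi>[OF that]
    by (simp add: homog_def \<psi>_def power2_eq_square power3_eq_cube algebra_simps)
  \<comment> \<open>The Hamel condition replaces the spray derivative of the vertical derivative of
    \<open>P\<close> by a base derivative, which leaves exactly twice a horizontal
    derivative.\<close>
  have dSP: "dd (0, a) SP z = 2 * hor_deriv s a P z" if z: "z \<in> W" for a z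
    unfolding SP_def base.dd_spray_deriv[OF smooth_P z] Q[OF z] base.hor_deriv_Pair[OF smooth_P z]
    by (simp add: dd_Pair[OF smooth_P z, of a "dd (0, a) s z"])
  \<comment> \<open>Commuting \<open>S\<close> with the horizontal lift brings in the curvature of
    \<open>S\<close>, known by \<open>R\<close>.\<close>
  have dSSP: "dd (0, a) SSP z = 3 * hor_deriv s a SP z + 2 * k * (E z * dd (0, a) P z - 1/2 * dd (0, a) E z * P z)"
    if z: "z \<in> W" for a z
  proof -
    have "spray_deriv s (dd (0, a) SP) z = dd (snd z, s z) (\<lambda>z. 2 * hor_deriv s a P z) z"
      unfolding spray_deriv_def by (intro dd_cong[OF open_W z] dSP)
    also have "\<dots> = 2 * spray_deriv s (hor_deriv s a P) z"
      unfolding spray_deriv_def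
      by (rule dd_eqI) (intro has_derivative_mult_right smooth_on_has_derivative[OF base.smooth_on_hor_deriv[OF smooth_P] z])
    finally have 1: "spray_deriv s (dd (0, a) SP) z = 2 * spray_deriv s (hor_deriv s a P) z" .
    have "dd (0, curv s a z) P z = k * (E z * dd (0, a) P z - 1/2 * dd (0, a) E z * P z)"
      unfolding R[OF z] dd_lin_snd[OF smooth_P z] using homog_P z by (simp add: homog_def)
    moreover have "dd (0, a) SSP z = spray_deriv s (dd (0, a) SP) z + (dd (a, 0) SP z + dd (0, dd (0, a) s z) SP z)"
      unfolding SSP_def base.dd_spray_deriv[OF sSP z] by (simp add: dd_Pair[OF sSP z, of a "dd (0, a) s z"])
    ultimately show ?thesis
      using base.spray_hor_commutator[OF smooth_P z, of a] dSP[OF z, of "dd (0, a) s z"] 1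
        base.hor_deriv_Pair[OF sSP z, of a]
      by (simp add: SP_def[symmetric] algebra_simps)
  qed
  \<comment> \<open>The factor \<open>3\<close> matches the one of \<open>hor_deriv s a SP\<close>
    in \<open>dSSP\<close>.\<close>
  have H\<rho>: "3 * hor_deriv s' a \<rho> z = dd (0, a) \<psi> z" if z: "z \<in> W" for a z
  proof -
    have "hor_deriv s a \<rho> z = k * hor_deriv s a E z + 2 * P z * hor_deriv s a P z - hor_deriv s a SP z"
      unfolding hor_deriv_def by (rule d\<rho>[OF z])
    then show ?thesis
      unfolding hor_deriv_deformed[OF s\<rho> z] h\<rho>[OF z] HE[OF z] d\<rho>[OF z, of "(0, a)"] d\<psi>[OF z] dSP[OF z, of a] dSSP[OF z]
      by (simp add: \<rho>_def power2_eq_square algebra_simps)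
  qed
  have curv': "curv s' a z = \<rho> z *\<^sub>R a - (1/2 * dd (0, a) \<rho> z) *\<^sub>R snd z" if z: "z \<in> W" for a z
    unfolding curv_deformed[OF z] R[OF z] Q[OF z] d\<rho>[OF z] dSP[OF z] \<rho>_def SP_def[symmetric]
    by (simp add: base.hor_deriv_Pair[OF smooth_P z] algebra_simps)
  \<comment> \<open>The vertical differential of \<open>E'\<close> annihilates the deformed
    curvature and takes the value \<open>2 E'\<close> on \<open>y\<close>. Hence it is proportional
    to that of \<open>\<rho>\<close>, so \<open>\<kappa>\<close> has no vertical derivative.\<close>
  have proportional: "\<rho> z * dd (0, a) E' z = dd (0, a) \<rho> z * E' z" if z: "z \<in> W" for a z
    using deformed.dd_curv_energy[OF E' SE' HE' z, of a] hE' z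
    unfolding curv'[OF z] dd_lin_snd[OF E' z] by (simp add: homog_def)
  have d\<kappa>: "dd u \<kappa> z = (dd u \<rho> z * E' z - \<rho> z * dd u E' z) / (E' z * E' z)" if z: "z \<in> W" for u z
    unfolding \<kappa> using pos[OF z] by (intro dd_eqI has_derivative_divide' smooth_on_has_derivative[OF s\<rho> z]
        smooth_on_has_derivative[OF E' z]) auto
  have V\<kappa>: "dd (0, a) \<kappa> z = 0" if "z \<in> W" for a z
    unfolding d\<kappa>[OF that] using proportional[OF that] by simp
  have H\<kappa>: "hor_deriv s' a \<rho> z = E' z * dd (a, 0) \<kappa> z" if z: "z \<in> W" for a z
  proof -
    have "hor_deriv s' a \<kappa> z = dd (a, 0) \<kappa> z"
      unfolding deformed.hor_deriv_Pair[OF s\<kappa> z] by (simp add: V\<kappa>[OF z])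
    moreover have "hor_deriv s' a \<kappa> z = hor_deriv s' a \<rho> z / E' z"
      using HE'[OF z, of a] pos[OF z] unfolding hor_deriv_def d\<kappa>[OF z] by simp
    ultimately show ?thesis using pos[OF z] by (simp add: field_simps)
  qed
  have V\<psi>: "dd (0, a) \<psi> z = 3 * (E' z * dd (a, 0) \<kappa> z)" if "z \<in> W" for a z
    using H\<rho>[OF that] H\<kappa>[OF that] by simp
  have V\<kappa>x: "dd (0, b) (dd (a, 0) \<kappa>) z = 0" if z: "z \<in> W" for a b z
  proof -
    have "dd (0, b) (dd (a, 0) \<kappa>) z = dd (a, 0) (dd (0, b) \<kappa>) z" by (rule dd_commute[OF open_W s\<kappa> z])
    also have "\<dots> = dd (a, 0) (\<lambda>_. 0) z" by (intro dd_cong[OF open_W z] V\<kappa>)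
    also have "\<dots> = 0" by (rule dd_eqI) (rule has_derivative_const)
    finally show ?thesis .
  qed
  have smooth_y: "smooth_on W (\<lambda>z. dd (snd z, 0) \<kappa> z)"
    by (intro smooth_on_field[OF open_W s\<kappa>] smooth_on_Pair[OF open_W] smooth_on_snd[OF open_W] smooth_on_const[OF open_W])
  \<comment> \<open>As \<open>\<kappa>\<close> has no vertical derivative, its derivative along
    \<open>y\<close> depends on the fibre only through the direction.\<close>
  have dy: "dd (0, a) (\<lambda>z. dd (snd z, 0) \<kappa> z) z = dd (a, 0) \<kappa> z" if z: "z \<in> W" for a z
  proof -
    have "((\<lambda>z::'e \<times> 'e. (snd z, 0::'e)) has_derivative (\<lambda>u. (snd u, 0))) (at z)"
      by (auto intro!: derivative_eq_intros)
    from dd_field[OF open_W s\<kappa> z this, of "(0, a)"]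
    have "dd (0, a) (\<lambda>z. dd (snd z, 0) \<kappa> z) z = dd (snd z, 0) (dd (0, a) \<kappa>) z + dd (a, 0) \<kappa> z" by simp
    then show ?thesis using V\<kappa>x[OF z, of a "snd z"] dd_commute[OF open_W s\<kappa> z] by simp
  qed
  \<comment> \<open>For \<open>a = y\<close> the degree \<open>3\<close> of \<open>\<psi>\<close>
    turns \<open>V\<psi>\<close> into a formula for \<open>\<psi>\<close> itself; its vertical
    derivative is compared with \<open>V\<psi>\<close>.\<close>
  have key: "2 * (E' z * dd (a, 0) \<kappa> z) = dd (0, a) E' z * dd (snd z, 0) \<kappa> z" if z: "z \<in> W" for a z
  proof -
    have "\<psi> z = E' z * dd (snd z, 0) \<kappa> z" if "z \<in> W" for z
      using V\<psi>[OF that, of "snd z"] h\<psi>[OF that] by simp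
    then have "dd (0, a) \<psi> z = dd (0, a) (\<lambda>z. E' z * dd (snd z, 0) \<kappa> z) z"
      by (intro dd_cong[OF open_W z])
    also have "\<dots> = E' z * dd (a, 0) \<kappa> z + dd (0, a) E' z * dd (snd z, 0) \<kappa> z"
      by (rule dd_eqI[OF has_derivative_mult[OF smooth_on_has_derivative[OF E' z] smooth_on_has_derivative[OF smooth_y z]],
            of "(0, a)", unfolded dy[OF z]])
    finally show ?thesis unfolding V\<psi>[OF z] by simp
  qed
  \<comment> \<open>A linear form has a nontrivial kernel in dimension at least two: it contains a
    basis vector or a combination of two of them.\<close>
  obtain e where e: "e \<noteq> 0" "dd (0, e) E' z = 0"
  proof -
    obtain c d :: 'e where cd: "c \<in> Basis" "d \<in> Basis" "c \<noteq> d"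
      using dim by (metis card_2_iff' card_le_Suc0_iff_eq finite_Basis not_less_eq_eq numeral_2_eq_2)
    show ?thesis
    proof (cases "dd (0, c) E' z = 0")
      case True
      then show ?thesis using that[of c] nonzero_Basis[OF cd(1)] by blast
    next
      case False
      let ?a = "dd (0, d) E' z *\<^sub>R c - dd (0, c) E' z *\<^sub>R d"
      have "?a \<bullet> d = - dd (0, c) E' z" using cd by (simp add: inner_simps inner_Basis)
      then have "?a \<noteq> 0" using False by auto
      moreover have "dd (0, ?a) E' z = 0" by (simp only: dd_lin_snd[OF E' z]) simp
      ultimately show ?thesis using that by blast
    qed
  qed
  \<comment> \<open>Along \<open>e\<close> both \<open>dd (0, e) E'\<close> and the mixed derivative
    of \<open>\<kappa>\<close> vanish. What remains of \<open>key\<close> is the second derivative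
    of \<open>E'\<close>, positive by convexity, times the derivative of \<open>\<kappa>\<close>
    along \<open>y\<close>.\<close>
  have "dd (0, e) (\<lambda>z. 2 * (E' z * dd (e, 0) \<kappa> z)) z = dd (0, e) (\<lambda>z. dd (0, e) E' z * dd (snd z, 0) \<kappa> z) z"
    by (intro dd_cong[OF open_W z] key)
  moreover have "dd (0, e) (\<lambda>z. 2 * (E' z * dd (e, 0) \<kappa> z)) z =
      2 * (E' z * dd (0, e) (dd (e, 0) \<kappa>) z + dd (0, e) E' z * dd (e, 0) \<kappa> z)"
    by (rule dd_eqI) (intro has_derivative_mult_right has_derivative_mult smooth_on_has_derivative[OF E' z]
        smooth_on_has_derivative[OF smooth_on_dd[OF s\<kappa>] z])
  moreover have "dd (0, e) (\<lambda>z. dd (0, e) E' z * dd (snd z, 0) \<kappa> z) z =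
      dd (0, e) E' z * dd (0, e) (\<lambda>z. dd (snd z, 0) \<kappa> z) z + dd (0, e) (dd (0, e) E') z * dd (snd z, 0) \<kappa> z"
    by (rule dd_eqI) (intro has_derivative_mult smooth_on_has_derivative[OF smooth_on_dd[OF E'] z]
        smooth_on_has_derivative[OF smooth_y z])
  ultimately have "dd (0, e) (dd (0, e) E') z * dd (snd z, 0) \<kappa> z = 0"
    by (simp add: e V\<kappa>x[OF z])
  then have "dd (snd z, 0) \<kappa> z = 0" using convex[OF z e(1)] by simp
  then have "dd (b, 0) \<kappa> z = 0" for b using key[OF z, of b] pos[OF z] by simp
  then have "dd u \<kappa> z = 0" for u using dd_Pair[OF s\<kappa> z, of "fst u" "snd u"] V\<kappa>[OF z] by simp
  then show "(\<kappa> has_derivative (\<lambda>_. 0)) (at z)" using smooth_on_has_derivative[OF s\<kappa> z] by simp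
  show "curv s' a z = \<kappa> z *\<^sub>R (E' z *\<^sub>R a - (1/2 * dd (0, a) E' z) *\<^sub>R snd z)"
    unfolding curv'[OF z] using pos[OF z] proportional[OF z, of a] by (simp add: \<kappa> algebra_simps)
qed

end

section \<open>Charts of the slit tangent bundle\<close>

locale atlas =
  fixes A :: "('m, 'e::euclidean_space) chart set"
  assumes smooth_atlas: "smooth_atlas A"
begin

section \<open>Tangent vectors and changes of charts\<close>

lemma inj_chart_map: "c \<in> A \<Longrightarrow> inj_on (chart_map c) (chart_dom c)"
  and open_chart_range: "c \<in> A \<Longrightarrow> open (chart_range c)"
  and open_overlap: "c \<in> A \<Longrightarrow> c' \<in> A \<Longrightarrow> open (chart_map c ` (chart_dom c \<inter> chart_dom c'))"
  and smooth_transition: "c \<in> A \<Longrightarrow> c' \<in> A \<Longrightarrow>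
    smooth_on (chart_map c ` (chart_dom c \<inter> chart_dom c')) (transition c c')"
  using smooth_atlas unfolding smooth_atlas_def by blast+

lemma chart_inv_map: "c \<in> A \<Longrightarrow> p \<in> chart_dom c \<Longrightarrow> chart_inv c (chart_map c p) = p"
  unfolding chart_inv_def by (simp add: inj_chart_map)

lemma transition_chart_map: "c \<in> A \<Longrightarrow> p \<in> chart_dom c \<Longrightarrow> transition c c' (chart_map c p) = chart_map c' p"
  unfolding transition_def by (simp add: chart_inv_map)

lemma transition_differentiable:
  assumes "c \<in> charts_at A p" "c' \<in> charts_at A p"
  shows "transition c c' differentiable (at (chart_map c p))"
  using assms by (intro smooth_on_differentiable[OF smooth_transition]) (auto simp: charts_at_def)

text \<open>The chain rule in cocycle form. It makes the extension of a component vector from one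
  chart to all others obey the transformation law.\<close>

lemma dd_transition_trans:
  assumes "c \<in> charts_at A p" "c' \<in> charts_at A p" "c'' \<in> charts_at A p"
  shows "dd (dd u (transition c c') (chart_map c p)) (transition c' c'') (chart_map c' p) =
    dd u (transition c c'') (chart_map c p)"
proof -
  have A: "c \<in> A" "c' \<in> A" "p \<in> chart_dom c" "p \<in> chart_dom c'" using assms by (auto simp: charts_at_def)
  have "(transition c' c'' has_derivative (\<lambda>u. dd u (transition c' c'') (transition c c' (chart_map c p))))
      (at (transition c c' (chart_map c p)))"
    by (rule has_derivative_dd)
      (simp add: transition_chart_map[OF A(1,3)] transition_differentiable[OF assms(2,3)])
  note has_derivative_compose[OF has_derivative_dd[OF transition_differentiable[OF assms(1,2)]] this]
  then have "dd u (\<lambda>x. transition c' c'' (transition c c' x)) (chart_map c p) =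
      dd (dd u (transition c c') (chart_map c p)) (transition c' c'') (chart_map c' p)"
    by (simp add: dd_eqI transition_chart_map[OF A(1,3)])
  moreover have "dd u (\<lambda>x. transition c' c'' (transition c c' x)) (chart_map c p) = dd u (transition c c'') (chart_map c p)"
    using A by (intro dd_cong[OF open_overlap[OF A(1,2)]]) (auto simp: transition_chart_map)
  ultimately show ?thesis by simp
qed

lemma dd_transition_self:
  assumes "c \<in> charts_at A p"
  shows "dd u (transition c c) (chart_map c p) = u"
proof -
  have A: "c \<in> A" "p \<in> chart_dom c" using assms by (auto simp: charts_at_def)
  have "dd u (transition c c) (chart_map c p) = dd u (\<lambda>x. x) (chart_map c p)"
    using A by (intro dd_cong[OF open_overlap[OF A(1,1)]]) (auto simp: transition_chart_map)
  then show ?thesis by (simp add: dd_def)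
qed

lemma tangent_space_outside: "v \<in> tangent_space A p \<Longrightarrow> c \<notin> charts_at A p \<Longrightarrow> v c = 0"
  unfolding tangent_space_def by blast

lemma tangent_space_dd:
  "v \<in> tangent_space A p \<Longrightarrow> c \<in> charts_at A p \<Longrightarrow> c' \<in> charts_at A p \<Longrightarrow>
    v c' = dd (v c) (transition c c') (chart_map c p)"
  unfolding tangent_space_def dd_def by blast

lemma tangent_space_eqI:
  assumes "v \<in> tangent_space A p" "w \<in> tangent_space A p" "c \<in> charts_at A p" "v c = w c"
  shows "v = w"
proof (rule ext)
  fix c'
  show "v c' = w c'"
  proof (cases "c' \<in> charts_at A p")
    case True
    show ?thesis
      unfolding tangent_space_dd[OF assms(1,3) True] tangent_space_dd[OF assms(2,3) True] assms(4) by (rule refl)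
  next
    case False
    then show ?thesis using assms(1,2) tangent_space_outside by metis
  qed
qed

lemma zero_tangent_space: "(\<lambda>_. 0) \<in> tangent_space A p"
  by (simp add: tangent_space_def dd_def[symmetric] linear_0[OF dd_linear[OF transition_differentiable]])

lemma scale_tangent_space:
  assumes "v \<in> tangent_space A p"
  shows "(\<lambda>c. r *\<^sub>R v c) \<in> tangent_space A p"
  unfolding tangent_space_def mem_Collect_eq dd_def[symmetric]
proof (intro conjI ballI allI impI)
  fix c c' assume c: "c \<in> charts_at A p" "c' \<in> charts_at A p"
  show "r *\<^sub>R v c' = dd (r *\<^sub>R v c) (transition c c') (chart_map c p)"
    unfolding tangent_space_dd[OF assms c] linear_scale[OF dd_linear[OF transition_differentiable[OF c]]] by (rule refl)
next
  fix c assume "c \<notin> charts_at A p"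
  then show "r *\<^sub>R v c = 0" using tangent_space_outside[OF assms] by simp
qed

lemma tangent_space_exists:
  assumes "c \<in> charts_at A p"
  obtains v where "v \<in> tangent_space A p" "v c = e"
proof
  let ?v = "\<lambda>c'. if c' \<in> charts_at A p then dd e (transition c c') (chart_map c p) else 0"
  show "?v \<in> tangent_space A p"
    by (simp add: tangent_space_def dd_def[symmetric] dd_transition_trans[OF assms])
  show "?v c = e" using assms by (simp add: dd_transition_self)
qed

section \<open>Induced charts and their ranges\<close>

abbreviation slit_chart :: "('m, 'e) chart \<Rightarrow> (('m, 'e) tangent, 'e \<times> 'e) chart" where
  "slit_chart c \<equiv> induced_chart (slit_bundle A) c"

lemma slit_bundle_iff:
  "q \<in> slit_bundle A \<longleftrightarrow> fst q \<in> points A \<and> snd q \<in> tangent_space A (fst q) \<and> snd q \<noteq> (\<lambda>_. 0)"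
  by (auto simp: slit_bundle_def tangent_bundle_def)

lemma slit_chart_simps:
  "q \<in> chart_dom (slit_chart c) \<longleftrightarrow> q \<in> slit_bundle A \<and> fst q \<in> chart_dom c"
  "chart_map (slit_chart c) q = (chart_map c (fst q), snd q c)"
  by (auto simp: induced_chart_def split: prod.splits)

lemma slit_chart_nonzero:
  assumes "c \<in> A" "q \<in> chart_dom (slit_chart c)"
  shows "snd q c \<noteq> 0"
proof
  assume "snd q c = 0"
  moreover have "c \<in> charts_at A (fst q)" "snd q \<in> tangent_space A (fst q)" "snd q \<noteq> (\<lambda>_. 0)"
    using assms by (auto simp: slit_chart_simps slit_bundle_iff charts_at_def)
  ultimately show False using tangent_space_eqI[OF _ zero_tangent_space, of "snd q" "fst q" c] by simp
qed

lemma inj_slit_chart: "c \<in> A \<Longrightarrow> inj_on (chart_map (slit_chart c)) (chart_dom (slit_chart c))"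
proof (rule inj_onI)
  fix q q' assume c: "c \<in> A" and q: "q \<in> chart_dom (slit_chart c)" "q' \<in> chart_dom (slit_chart c)"
    and eq: "chart_map (slit_chart c) q = chart_map (slit_chart c) q'"
  then have p: "fst q = fst q'"
    using inj_onD[OF inj_chart_map[OF c]] by (auto simp: slit_chart_simps)
  moreover have "snd q = snd q'"
    using q eq p c by (intro tangent_space_eqI[of _ "fst q" _ c])
      (auto simp: slit_chart_simps slit_bundle_iff charts_at_def)
  ultimately show "q = q'" by (rule prod_eqI)
qed

text \<open>Every vector is the component vector of some tangent vector, and a nonzero tangent
  vector has nonzero components in every chart around its base point.\<close>

lemma slit_chart_range:
  assumes "c \<in> A"
  shows "chart_range (slit_chart c) = chart_range c \<times> (- {0})"
proof (intro equalityI subsetI)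
  fix z assume "z \<in> chart_range (slit_chart c)"
  then show "z \<in> chart_range c \<times> (- {0})"
    using slit_chart_nonzero[OF assms] unfolding chart_range_def by (auto simp: slit_chart_simps)
next
  fix z :: "'e \<times> 'e" assume z: "z \<in> chart_range c \<times> (- {0})"
  then have "fst z \<in> chart_map c ` chart_dom c" unfolding chart_range_def by auto
  then obtain p where p: "p \<in> chart_dom c" "fst z = chart_map c p" by blast
  obtain v where v: "v \<in> tangent_space A p" "v c = snd z"
    using tangent_space_exists[of c p "snd z"] p assms by (auto simp: charts_at_def)
  have "v \<noteq> (\<lambda>_. 0)" using v z by auto
  then have "(p, v) \<in> chart_dom (slit_chart c)"
    using v p assms by (auto simp: slit_chart_simps slit_bundle_iff points_def)
  moreover have "chart_map (slit_chart c) (p, v) = z" using v p by (simp add: slit_chart_simps prod_eq_iff)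
  ultimately show "z \<in> chart_range (slit_chart c)" unfolding chart_range_def by blast
qed

lemma open_slit_chart_range: "c \<in> A \<Longrightarrow> open (chart_range (slit_chart c))"
  by (simp add: slit_chart_range open_chart_range open_Times open_Compl)

lemma slit_chart_inv:
  assumes "z \<in> chart_range (slit_chart c)"
  shows "chart_inv (slit_chart c) z \<in> chart_dom (slit_chart c)"
    "chart_map (slit_chart c) (chart_inv (slit_chart c) z) = z"
  using assms unfolding chart_inv_def chart_range_def by (auto intro: inv_into_into f_inv_into_f)

lemma slit_chart_inv_map:
  "c \<in> A \<Longrightarrow> q \<in> chart_dom (slit_chart c) \<Longrightarrow> chart_inv (slit_chart c) (chart_map (slit_chart c) q) = q"
  unfolding chart_inv_def by (simp add: inj_slit_chart)

lemma slit_chart_map_in_range: "q \<in> chart_dom (slit_chart c) \<Longrightarrow> chart_map (slit_chart c) q \<in> chart_range (slit_chart c)"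
  by (simp add: chart_range_def)

lemma charts_at_slit_atlas:
  "charts_at (slit_atlas A) q = {slit_chart c | c. c \<in> A \<and> q \<in> chart_dom (slit_chart c)}"
  by (auto simp: charts_at_def slit_atlas_def)

text \<open>Carries equalities of vector fields, tensors and forms over to coordinates;
  \<open>Q\<close> stands for the pointwise equation.\<close>

lemma ball_slit_atlas:
  "(\<forall>q\<in>points (slit_atlas A). \<forall>C\<in>charts_at (slit_atlas A) q. Q q C) \<longleftrightarrow>
    (\<forall>c\<in>A. \<forall>z\<in>chart_range (slit_chart c). Q (chart_inv (slit_chart c) z) (slit_chart c))"
proof (intro iffI ballI)
  fix c z assume *: "\<forall>q\<in>points (slit_atlas A). \<forall>C\<in>charts_at (slit_atlas A) q. Q q C"
    and c: "c \<in> A" and z: "z \<in> chart_range (slit_chart c)"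
  show "Q (chart_inv (slit_chart c) z) (slit_chart c)"
    using slit_chart_inv(1)[OF z] c * unfolding charts_at_slit_atlas by (auto simp: points_def slit_atlas_def)
next
  fix q C assume *: "\<forall>c\<in>A. \<forall>z\<in>chart_range (slit_chart c). Q (chart_inv (slit_chart c) z) (slit_chart c)"
    and "C \<in> charts_at (slit_atlas A) q"
  then obtain c where c: "c \<in> A" "q \<in> chart_dom (slit_chart c)" "C = slit_chart c"
    by (auto simp: charts_at_slit_atlas)
  then show "Q q C"
    using *[rule_format, OF c(1) slit_chart_map_in_range[OF c(2)]] by (simp add: slit_chart_inv_map)
qed

lemma fibre_scale_slit_chart:
  assumes "c \<in> A" "q \<in> chart_dom (slit_chart c)" "r > 0"
  shows "fibre_scale r q \<in> chart_dom (slit_chart c)"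
    and "chart_map (slit_chart c) (fibre_scale r q) = (fst (chart_map (slit_chart c) q), r *\<^sub>R snd (chart_map (slit_chart c) q))"
proof -
  have "(\<lambda>c. r *\<^sub>R snd q c) \<noteq> (\<lambda>_. 0)"
    using slit_chart_nonzero[OF assms(1,2)] assms(3) by (auto simp: fun_eq_iff)
  then show "fibre_scale r q \<in> chart_dom (slit_chart c)"
    using assms by (cases q) (auto simp: slit_chart_simps fibre_scale_def slit_bundle_iff intro: scale_tangent_space)
  show "chart_map (slit_chart c) (fibre_scale r q) = (fst (chart_map (slit_chart c) q), r *\<^sub>R snd (chart_map (slit_chart c) q))"
    by (cases q) (simp add: slit_chart_simps fibre_scale_def)
qed

abbreviation local_fun :: "('m, 'e) chart \<Rightarrow> (('m, 'e) tangent \<Rightarrow> 'b) \<Rightarrow> 'e \<times> 'e \<Rightarrow> 'b" where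
  "local_fun c f \<equiv> f \<circ> chart_inv (slit_chart c)"

lemma smooth_on_local_fun:
  "smooth_function (slit_atlas A) f \<Longrightarrow> c \<in> A \<Longrightarrow> smooth_on (chart_range (slit_chart c)) (local_fun c f)"
  by (auto simp: smooth_function_def slit_atlas_def)

text \<open>The function at \<open>(x, r y)\<close> is differentiated in \<open>r\<close> at
  \<open>r = 1\<close>, once by the chain rule and once through \<open>r ^ k\<close>.\<close>

lemma homog_local_fun:
  assumes sm: "smooth_function (slit_atlas A) f" and c: "c \<in> A" and hom: "pos_homogeneous_on (slit_bundle A) k f"
  shows "homog (chart_range (slit_chart c)) k (local_fun c f)"
  unfolding homog_def
proof
  let ?W = "chart_range (slit_chart c)" and ?f = "local_fun c f"
  fix z assume z: "z \<in> ?W"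
  let ?q = "chart_inv (slit_chart c) z"
  note q = slit_chart_inv[OF z]
  have scale: "?f (fst z, r *\<^sub>R snd z) = r ^ k * ?f z" if "r > 0" for r
  proof -
    have "chart_inv (slit_chart c) (fst z, r *\<^sub>R snd z) = fibre_scale r ?q"
      using slit_chart_inv_map[OF c fibre_scale_slit_chart(1)[OF c q(1) that]]
        fibre_scale_slit_chart(2)[OF c q(1) that] q(2) by simp
    moreover have "f (fibre_scale r ?q) = r ^ k * f ?q"
      using hom that q(1) by (simp add: pos_homogeneous_on_def slit_chart_simps)
    ultimately show ?thesis by simp
  qed
  have "((\<lambda>r. (fst z, r *\<^sub>R snd z)) has_derivative (\<lambda>h. (0, h *\<^sub>R snd z))) (at 1)"
    by (auto intro!: derivative_eq_intros)
  moreover have "(?f has_derivative (\<lambda>u. dd u ?f z)) (at (fst z, 1 *\<^sub>R snd z))"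
    using smooth_on_has_derivative[OF smooth_on_local_fun[OF sm c] z] by simp
  ultimately have "((\<lambda>r. ?f (fst z, r *\<^sub>R snd z)) has_derivative (\<lambda>h. dd (0, h *\<^sub>R snd z) ?f z)) (at 1)"
    by (rule has_derivative_compose)
  moreover have "((\<lambda>r. ?f (fst z, r *\<^sub>R snd z)) has_derivative (\<lambda>h. h * (k * ?f z))) (at 1)"
  proof -
    have "((\<lambda>r. r ^ k * ?f z) has_derivative (\<lambda>h. h * (k * ?f z))) (at (1::real))"
      by (auto intro!: derivative_eq_intros)
    then show ?thesis
      by (rule has_derivative_transform_within_open[of _ _ _ _ "{0<..}"]) (use scale in \<open>auto simp: o_def\<close>)
  qed
  ultimately have "(\<lambda>h. dd (0, h *\<^sub>R snd z) ?f z) = (\<lambda>h. h * (k * ?f z))"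
    by (rule has_derivative_unique)
  from fun_cong[OF this, of 1] show "dd (0, snd z) ?f z = real k *\<^sub>R ?f z" by simp
qed

lemma chart_deriv_slit_chart:
  assumes "z \<in> chart_range (slit_chart c)"
  shows "chart_deriv (slit_chart c) f (chart_inv (slit_chart c) z) u = dd u (local_fun c f) z"
  by (simp add: chart_deriv_def dd_def slit_chart_inv[OF assms])

end

section \<open>Coordinate expressions of the tensor operations\<close>

lemma chart_deriv_const: "chart_deriv c (\<lambda>q. k) q u = 0"
  by (simp add: chart_deriv_def o_def)

text \<open>Forms are defined on lists of every length, so the formula also has to record the
  vanishing outside degree one.\<close>

lemma ext_d_fun_form: "ext_d (fun_form f) q c us = (if length us = 1 then chart_deriv c f q (us ! 0) else 0)"
proof (cases "length us = 1")
  case True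
  then show ?thesis by (auto simp: ext_d_def fun_form_def)
next
  case False
  have "fun_form f q c (take i us @ drop (Suc i) us) = 0" if "i < length us" for i q
    using that False by (cases us) (auto simp: fun_form_def)
  then show ?thesis using False by (simp add: ext_d_def chart_deriv_const)
qed

text \<open>The insertion of \<open>K\<close> into a function vanishes in every degree, which leaves
  \<open>df\<close> composed with \<open>K\<close>.\<close>

lemma d_tensor_fun_form:
  "d_tensor K (fun_form f) q c us = (if length us = 1 then chart_deriv c f q (K q c (us ! 0)) else 0)"
proof -
  have "ins_tensor K (fun_form f) q c us = 0" for q us
    by (auto simp: ins_tensor_def fun_form_def)
  then have "ext_d (ins_tensor K (fun_form f)) q c us = 0"
    by (simp add: ext_d_def chart_deriv_const)
  then show ?thesis
    by (auto simp: d_tensor_def ins_tensor_def ext_d_fun_form)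
qed

lemma ext_d_one_form:
  assumes "\<And>q us. length us \<noteq> 1 \<Longrightarrow> \<theta> q c us = 0"
  shows "ext_d \<theta> q c us = (if length us = 2
    then chart_deriv c (\<lambda>q. \<theta> q c [us ! 1]) q (us ! 0) - chart_deriv c (\<lambda>q. \<theta> q c [us ! 0]) q (us ! 1) else 0)"
proof (cases "length us = 2")
  case True
  then obtain u0 u1 where "us = [u0, u1]" by (auto simp: length_Suc_conv numeral_2_eq_2)
  then show ?thesis by (simp add: ext_d_def numeral_2_eq_2)
next
  case False
  have "\<theta> q c (take i us @ drop (Suc i) us) = 0" if "i < length us" for i q
    using that False by (intro assms) auto
  then show ?thesis using False by (simp add: ext_d_def chart_deriv_const)
qed

section \<open>Sprays, projectors and curvature in induced charts\<close>

context atlas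
begin

abbreviation slit_range :: "('m, 'e) chart \<Rightarrow> ('e \<times> 'e) set" where
  "slit_range c \<equiv> chart_range (slit_chart c)"

abbreviation point :: "('m, 'e) chart \<Rightarrow> 'e \<times> 'e \<Rightarrow> ('m, 'e) tangent" where
  "point c \<equiv> chart_inv (slit_chart c)"

text \<open>Only the vertical component is kept, as \<open>J S = C\<close> fixes the base component
  to be \<open>y\<close>. In the usual notation this is \<open>-2 G\<close>.\<close>

definition spray_coeff :: "('m, 'e) chart \<Rightarrow> (('m, 'e) tangent, 'e \<times> 'e) vfield \<Rightarrow> 'e \<times> 'e \<Rightarrow> 'e" where
  "spray_coeff c S z = snd (S (point c z) (slit_chart c))"

lemma liouville_slit_chart: "z \<in> slit_range c \<Longrightarrow> liouville (point c z) (slit_chart c) = (0, snd z)"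
  by (simp add: liouville_def slit_chart_inv(2))

lemma lie_bracket_slit_chart:
  assumes "z \<in> slit_range c"
  shows "lie_bracket X Y (point c z) (slit_chart c) =
    dd (X (point c z) (slit_chart c)) (\<lambda>z. Y (point c z) (slit_chart c)) z
    - dd (Y (point c z) (slit_chart c)) (\<lambda>z. X (point c z) (slit_chart c)) z"
  by (simp add: lie_bracket_def chart_deriv_slit_chart[OF assms] o_def)

lemma spray_slit_chart:
  assumes "spray A S" "c \<in> A" "z \<in> slit_range c"
  shows "S (point c z) (slit_chart c) = (snd z, spray_coeff c S z)"
proof -
  have "vert_endo (point c z) (slit_chart c) (S (point c z) (slit_chart c)) = liouville (point c z) (slit_chart c)"
    using assms unfolding spray_def vfield_eq_def ball_slit_atlas by blast
  then show ?thesis by (simp add: liouville_slit_chart[OF assms(3)] vert_endo_def spray_coeff_def prod_eq_iff)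
qed

lemma smooth_spray_coeff:
  assumes "spray A S" "c \<in> A"
  shows "smooth_on (slit_range c) (spray_coeff c S)"
proof -
  have "smooth_on (slit_range c) (\<lambda>z. S (point c z) (slit_chart c))"
    using assms by (auto simp: spray_def smooth_vfield_def slit_atlas_def)
  from smooth_on_bounded_linear[OF open_slit_chart_range[OF assms(2)] bounded_linear_snd this]
  show ?thesis by (simp add: spray_coeff_def[abs_def])
qed

lemma dd_spray_slit_chart:
  assumes "spray A S" "c \<in> A" and z: "z \<in> slit_range c"
  shows "dd u (\<lambda>z. S (point c z) (slit_chart c)) z = (snd u, dd u (spray_coeff c S) z)"
proof -
  have "dd u (\<lambda>z. S (point c z) (slit_chart c)) z = dd u (\<lambda>z. (snd z, spray_coeff c S z)) z"
    by (intro dd_cong[OF open_slit_chart_range[OF assms(2)] z] spray_slit_chart[OF assms(1,2)])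
  also have "\<dots> = (snd u, dd u (spray_coeff c S) z)"
    by (rule dd_eqI) (intro has_derivative_Pair has_derivative_snd has_derivative_ident
        smooth_on_has_derivative[OF smooth_spray_coeff[OF assms(1,2)] z])
  finally show ?thesis .
qed

text \<open>The vertical component of \<open>[C, S] = S\<close> reads
  \<open>dd (0, y) s - s = s\<close>, which is Euler's relation of degree two.\<close>

lemma coord_spray_slit_chart:
  assumes "spray A S" "c \<in> A"
  shows "coord_spray (slit_range c) (spray_coeff c S)"
proof
  show "open (slit_range c)" by (rule open_slit_chart_range[OF assms(2)])
  show "smooth_on (slit_range c) (spray_coeff c S)" by (rule smooth_spray_coeff[OF assms])
  show "homog (slit_range c) 2 (spray_coeff c S)"
    unfolding homog_def
  proof
    fix z assume z: "z \<in> slit_range c"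
    have "lie_bracket liouville S (point c z) (slit_chart c) = S (point c z) (slit_chart c)"
      using assms z unfolding spray_def vfield_eq_def ball_slit_atlas by blast
    moreover have "dd u (\<lambda>z. liouville (point c z) (slit_chart c)) z = (0, snd u)" for u
    proof -
      have "dd u (\<lambda>z. liouville (point c z) (slit_chart c)) z = dd u (\<lambda>z. (0, snd z)) z"
        by (intro dd_cong[OF open_slit_chart_range[OF assms(2)] z] liouville_slit_chart)
      also have "\<dots> = (0, snd u)" by (rule dd_eqI) (auto intro!: derivative_eq_intros)
      finally show ?thesis .
    qed
    ultimately show "dd (0, snd z) (spray_coeff c S) z = 2 *\<^sub>R spray_coeff c S z"
      by (simp add: lie_bracket_slit_chart[OF z] dd_spray_slit_chart[OF assms z] spray_slit_chart[OF assms z]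
          liouville_slit_chart[OF z] scaleR_2 diff_eq_eq)
  qed
qed

text \<open>The bracket of \<open>S\<close> with the constant field \<open>u\<close> is minus the
  derivative of \<open>S\<close> along \<open>u\<close>, whence the last argument of
  \<open>K\<close>.\<close>

lemma lie_tensor_slit_chart:
  assumes "spray A S" "c \<in> A" and z: "z \<in> slit_range c"
  shows "lie_tensor S K (point c z) (slit_chart c) u =
    dd (snd z, spray_coeff c S z) (\<lambda>z. K (point c z) (slit_chart c) u) z
    - (snd (K (point c z) (slit_chart c) u), dd (K (point c z) (slit_chart c) u) (spray_coeff c S) z)
    - K (point c z) (slit_chart c) (- (snd u, dd u (spray_coeff c S) z))"
  by (simp add: lie_tensor_def lie_bracket_slit_chart[OF z] dd_spray_slit_chart[OF assms] spray_slit_chart[OF assms]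
      dd_def[of _ "\<lambda>z. u"])

lemma lie_vert_endo_slit_chart:
  assumes "spray A S" "c \<in> A" and z: "z \<in> slit_range c"
  shows "lie_tensor S vert_endo (point c z) (slit_chart c) u = (- fst u, snd u - dd (0, fst u) (spray_coeff c S) z)"
  unfolding lie_tensor_slit_chart[OF assms] vert_endo_def
  by (simp add: dd_def[of _ "\<lambda>z. (0, fst u)"])

lemma hor_proj_slit_chart:
  assumes "spray A S" "c \<in> A" and z: "z \<in> slit_range c"
  shows "hor_proj S (point c z) (slit_chart c) u = (fst u, (1/2) *\<^sub>R dd (0, fst u) (spray_coeff c S) z)"
  unfolding hor_proj_def lie_vert_endo_slit_chart[OF assms]
  by (auto simp: prod_eq_iff scaleR_2[symmetric])

lemma vert_proj_slit_chart:
  assumes "spray A S" "c \<in> A" and z: "z \<in> slit_range c"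
  shows "vert_proj S (point c z) (slit_chart c) u = (0, snd u - (1/2) *\<^sub>R dd (0, fst u) (spray_coeff c S) z)"
  unfolding vert_proj_def lie_vert_endo_slit_chart[OF assms]
  by (simp add: prod_eq_iff add_diff_eq scaleR_diff_right)

text \<open>Since \<open>\<Phi>\<close> is vertical and annihilates vertical vectors, the map
  \<open>curv\<close> on base directions describes it completely.\<close>

lemma jacobi_endo_slit_chart:
  assumes "spray A S" "c \<in> A" and z: "z \<in> slit_range c"
  shows "jacobi_endo S (point c z) (slit_chart c) u = (0, curv (spray_coeff c S) (fst u) z)"
proof -
  let ?s = "spray_coeff c S"
  interpret s: coord_spray "slit_range c" ?s by (rule coord_spray_slit_chart[OF assms(1,2)])
  note h = hor_proj_slit_chart[OF assms(1,2)]
  have "dd (snd z, ?s z) (\<lambda>z. hor_proj S (point c z) (slit_chart c) u) z =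
      dd (snd z, ?s z) (\<lambda>z. (fst u, (1/2) *\<^sub>R dd (0, fst u) ?s z)) z"
    by (intro dd_cong[OF open_slit_chart_range[OF assms(2)] z] h)
  also have "\<dots> = (0, (1/2) *\<^sub>R dd (snd z, ?s z) (dd (0, fst u) ?s) z)"
    by (rule dd_eqI) (intro has_derivative_Pair has_derivative_const has_derivative_scaleR_right
        smooth_on_has_derivative[OF smooth_on_dd[OF s.smooth_s] z])
  finally show ?thesis
    unfolding jacobi_endo_def lie_tensor_slit_chart[OF assms] h[OF z] vert_proj_slit_chart[OF assms]
      dd_Pair[OF s.smooth_s z, of "fst u" "(1/2) *\<^sub>R dd (0, fst u) ?s z"]
    by (simp add: curv_def spray_deriv_def dd_lin_snd[OF s.smooth_s z] algebra_simps)
      (simp add: scaleR_add_left[symmetric] algebra_simps)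
qed

section \<open>The forms d_J f, d d_J f and d_h d_J f in induced charts\<close>

lemma d_vert_endo_slit_chart:
  assumes "z \<in> slit_range c"
  shows "d_tensor vert_endo (fun_form f) (point c z) (slit_chart c) us =
    (if length us = 1 then dd (0, fst (us ! 0)) (local_fun c f) z else 0)"
  by (simp add: d_tensor_fun_form chart_deriv_slit_chart[OF assms] vert_endo_def)

lemma dd_d_vert_endo_slit_chart:
  assumes "c \<in> A" "z \<in> slit_range c"
  shows "dd v (\<lambda>z. d_tensor vert_endo (fun_form f) (point c z) (slit_chart c) [u]) z = dd v (dd (0, fst u) (local_fun c f)) z"
  by (intro dd_cong[OF open_slit_chart_range[OF assms(1)] assms(2)]) (simp add: d_vert_endo_slit_chart)

lemma ext_d_vert_endo_slit_chart:
  assumes "c \<in> A" "z \<in> slit_range c"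
  shows "ext_d (d_tensor vert_endo (fun_form f)) (point c z) (slit_chart c) us =
    (if length us = 2 then dd (us ! 0) (dd (0, fst (us ! 1)) (local_fun c f)) z
       - dd (us ! 1) (dd (0, fst (us ! 0)) (local_fun c f)) z else 0)"
proof -
  have "d_tensor vert_endo (fun_form f) q (slit_chart c) us = 0" if "length us \<noteq> 1" for q us
    using that by (simp add: d_tensor_fun_form)
  then show ?thesis
    by (simp add: ext_d_one_form chart_deriv_slit_chart[OF assms(2)] o_def dd_d_vert_endo_slit_chart[OF assms, unfolded o_def])
qed

text \<open>The form \<open>d_J f\<close> sees only base components, which the horizontal projector
  preserves. So \<open>i_h d_J f = d_J f\<close>, and its exterior derivative cancels the
  unprojected terms of \<open>i_h d d_J f\<close>.\<close>

lemma hamel_slit_chart: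
  assumes S: "spray A S" and c: "c \<in> A" and z: "z \<in> slit_range c"
  shows "d_tensor (hor_proj S) (d_tensor vert_endo (fun_form f)) (point c z) (slit_chart c) us =
    (if length us = 2 then hor_deriv (spray_coeff c S) (fst (us ! 0)) (dd (0, fst (us ! 1)) (local_fun c f)) z
       - hor_deriv (spray_coeff c S) (fst (us ! 1)) (dd (0, fst (us ! 0)) (local_fun c f)) z else 0)"
proof -
  let ?\<theta> = "d_tensor vert_endo (fun_form f)" and ?C = "slit_chart c" and ?h = "hor_proj S (point c z) (slit_chart c)"
  note h = hor_proj_slit_chart[OF S c]
  have ins: "ins_tensor (hor_proj S) ?\<theta> q C us = (if length us = 1 then ?\<theta> q C [hor_proj S q C (us ! 0)] else 0)" for q C us
    by (auto simp: ins_tensor_def d_tensor_fun_form)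
  have dins: "dd v (\<lambda>z. ?\<theta> (point c z) ?C [hor_proj S (point c z) ?C u]) z = dd v (dd (0, fst u) (local_fun c f)) z" for u v
    by (intro dd_cong[OF open_slit_chart_range[OF c] z]) (simp add: d_vert_endo_slit_chart h)
  have "ext_d (ins_tensor (hor_proj S) ?\<theta>) (point c z) ?C us = (if length us = 2
      then dd (us ! 0) (dd (0, fst (us ! 1)) (local_fun c f)) z - dd (us ! 1) (dd (0, fst (us ! 0)) (local_fun c f)) z else 0)"
    by (subst ext_d_one_form) (simp_all add: ins chart_deriv_slit_chart[OF z] o_def dins[unfolded o_def])
  moreover have "ins_tensor (hor_proj S) (ext_d ?\<theta>) (point c z) ?C us = (if length us = 2
      then hor_deriv (spray_coeff c S) (fst (us ! 0)) (dd (0, fst (us ! 1)) (local_fun c f)) z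
        - dd (us ! 1) (dd (0, fst (us ! 0)) (local_fun c f)) z
        + (dd (us ! 0) (dd (0, fst (us ! 1)) (local_fun c f)) z
        - hor_deriv (spray_coeff c S) (fst (us ! 1)) (dd (0, fst (us ! 0)) (local_fun c f)) z) else 0)"
    by (auto simp: ins_tensor_def ext_d_vert_endo_slit_chart[OF c z] h[OF z] hor_deriv_def numeral_2_eq_2)
  ultimately show ?thesis by (simp add: d_tensor_def)
qed

lemma hamel_function_iff:
  assumes "spray A S" and "smooth_function (slit_atlas A) P" and "pos_homogeneous_on (slit_bundle A) 1 P"
  shows "hamel_function A S P \<longleftrightarrow> (\<forall>c\<in>A. \<forall>z\<in>slit_range c. \<forall>a.
    spray_deriv (spray_coeff c S) (dd (0, a) (local_fun c P)) z = dd (a, 0) (local_fun c P) z)"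
proof -
  have "hamel_function A S P \<longleftrightarrow> (\<forall>c\<in>A. \<forall>z\<in>slit_range c. \<forall>us.
    d_tensor (hor_proj S) (d_tensor vert_endo (fun_form P)) (point c z) (slit_chart c) us = 0)"
    unfolding hamel_function_def form_eq_def ball_slit_atlas ..
  also have "\<dots> \<longleftrightarrow> (\<forall>c\<in>A. \<forall>z\<in>slit_range c. \<forall>a b. hor_deriv (spray_coeff c S) a (dd (0, b) (local_fun c P)) z =
      hor_deriv (spray_coeff c S) b (dd (0, a) (local_fun c P)) z)" (is "?L \<longleftrightarrow> ?R")
  proof (intro iffI ballI allI)
    fix c z a b assume *: ?L and "c \<in> A" "z \<in> slit_range c"
    then show "hor_deriv (spray_coeff c S) a (dd (0, b) (local_fun c P)) z =
      hor_deriv (spray_coeff c S) b (dd (0, a) (local_fun c P)) z"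
      using *[rule_format, of c z "[(a, 0), (b, 0)]"] by (simp add: hamel_slit_chart[OF assms(1)])
  next
    fix c z us assume ?R "c \<in> A" "z \<in> slit_range c"
    then show "d_tensor (hor_proj S) (d_tensor vert_endo (fun_form P)) (point c z) (slit_chart c) us = 0"
      by (simp add: hamel_slit_chart[OF assms(1)])
  qed
  also have "\<dots> \<longleftrightarrow> (\<forall>c\<in>A. \<forall>z\<in>slit_range c. \<forall>a.
    spray_deriv (spray_coeff c S) (dd (0, a) (local_fun c P)) z = dd (a, 0) (local_fun c P) z)"
  proof (rule ball_cong[OF refl])
    fix c assume c: "c \<in> A"
    have "homog (slit_range c) 1 (local_fun c P)"
      using homog_local_fun[OF assms(2) c assms(3)] by simp
    from coord_spray.hamel_iff[OF coord_spray_slit_chart[OF assms(1) c] smooth_on_local_fun[OF assms(2) c] this]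
    show "(\<forall>z\<in>slit_range c. \<forall>a b. hor_deriv (spray_coeff c S) a (dd (0, b) (local_fun c P)) z =
        hor_deriv (spray_coeff c S) b (dd (0, a) (local_fun c P)) z) \<longleftrightarrow>
      (\<forall>z\<in>slit_range c. \<forall>a. spray_deriv (spray_coeff c S) (dd (0, a) (local_fun c P)) z = dd (a, 0) (local_fun c P) z)" .
  qed
  finally show ?thesis .
qed

end

section \<open>From charts to the manifold\<close>

lemma curv_cong:
  assumes "open W" "z \<in> W" and eq: "\<And>z. z \<in> W \<Longrightarrow> s z = s' z"
  shows "curv s a z = curv s' a z"
proof -
  have d: "dd u s z = dd u s' z" if "z \<in> W" for u z
    by (rule dd_cong[OF assms(1) that eq])
  then have "dd v (dd u s) z = dd v (dd u s') z" for u v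
    by (intro dd_cong[OF assms(1,2)])
  then show ?thesis using d[OF assms(2)] eq[OF assms(2)] by (simp add: curv_def spray_deriv_def)
qed

context atlas
begin

text \<open>Needed because the candidate curvature contains \<open>S f\<close> with
  \<open>f = P\<close>, given chart by chart. The chain rule and the transformation law of
  \<open>S\<close> on the slit bundle make it a global function.\<close>

lemma spray_deriv_chart_independent:
  assumes f: "smooth_function (slit_atlas A) f" and S: "spray A S"
    and c: "c \<in> A" "c' \<in> A" and q: "q \<in> chart_dom (slit_chart c)" "q \<in> chart_dom (slit_chart c')"
  shows "chart_deriv (slit_chart c) f q (S q (slit_chart c)) = chart_deriv (slit_chart c') f q (S q (slit_chart c'))"
proof -
  let ?V = "chart_map c ` (chart_dom c \<inter> chart_dom c')" and ?t = "transition c c'"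
  let ?T = "transition (slit_chart c) (slit_chart c')" and ?z = "chart_map (slit_chart c) q"
  \<comment> \<open>The induced transition map is the transition map of the base together with its
    Jacobian acting on the fibre component.\<close>
  have overlap: "chart_inv (slit_chart c) z \<in> chart_dom (slit_chart c')" "?T z = chart_map (slit_chart c') (point c z)"
    "?T z = (?t (fst z), dd (snd z) ?t (fst z))" if z: "z \<in> ?V \<times> (- {0})" for z
  proof -
    have zr: "z \<in> slit_range c" using z unfolding slit_chart_range[OF c(1)] by (auto simp: chart_range_def)
    define r where "r = point c z"
    note r = slit_chart_inv[OF zr, folded r_def]
    have "fst z \<in> ?V" using z by (simp add: mem_Times_iff)
    then obtain p where p: "p \<in> chart_dom c" "p \<in> chart_dom c'" "fst z = chart_map c p" by blast
    have "fst r = p"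
      using r p inj_onD[OF inj_chart_map[OF c(1)], of "fst r" p] by (auto simp: slit_chart_simps)
    then show r': "point c z \<in> chart_dom (slit_chart c')"
      using r p by (simp add: slit_chart_simps r_def[symmetric])
    show T: "?T z = chart_map (slit_chart c') (point c z)" by (simp add: transition_def)
    have "snd r \<in> tangent_space A p" "c \<in> charts_at A p" "c' \<in> charts_at A p"
      using r(1) \<open>fst r = p\<close> p c by (auto simp: slit_chart_simps slit_bundle_iff charts_at_def)
    from tangent_space_dd[OF this] show "?T z = (?t (fst z), dd (snd z) ?t (fst z))"
      unfolding T using r(2) p \<open>fst r = p\<close> transition_chart_map[OF c(1) p(1)]
      by (auto simp: slit_chart_simps r_def[symmetric])
  qed
  have oV: "open (?V \<times> (- {0::'e}))" using open_overlap[OF c] by (intro open_Times) auto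
  have zV: "?z \<in> ?V \<times> (- {0})"
    using q slit_chart_nonzero[OF c(1) q(1)] by (auto simp: slit_chart_simps)
  \<comment> \<open>In the Jacobian part the direction varies with the point, so it is expanded in a
    basis before differentiating.\<close>
  have "?T differentiable (at ?z)"
  proof -
    have "(\<lambda>z. (?t (fst z), \<Sum>i\<in>Basis. (snd z \<bullet> i) *\<^sub>R dd i ?t (fst z))) differentiable (at ?z)"
    proof -
      have sm: "g \<circ> fst differentiable (at ?z)" if "smooth_on ?V g" for g :: "'e \<Rightarrow> 'e"
        using zV by (intro differentiable_chain_at smooth_on_differentiable[OF that]) (auto intro: bounded_linear_imp_differentiable bounded_linear_fst)
      note D = has_derivative_dd[OF sm[OF smooth_on_dd[OF smooth_transition[OF c]]]]
        and D0 = has_derivative_dd[OF sm[OF smooth_transition[OF c]]]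
      show ?thesis
        by (rule differentiableI, rule has_derivative_Pair[OF D0[unfolded o_def]], rule has_derivative_sum,
          rule has_derivative_scaleR[OF bounded_linear.has_derivative[OF bounded_linear_inner_left has_derivative_snd[OF has_derivative_ident]] D[unfolded o_def]])
    qed
    moreover have "?T z = (?t (fst z), \<Sum>i\<in>Basis. (snd z \<bullet> i) *\<^sub>R dd i ?t (fst z))" if z: "z \<in> ?V \<times> (- {0})" for z
      using overlap(3)[OF z] dd_expand[OF smooth_on_differentiable[OF smooth_transition[OF c]], of "fst z" "snd z"] z by auto
    ultimately show ?thesis
      by (rule differentiable_cong_open[OF oV zV, THEN iffD2, rotated])
  qed
  from has_derivative_dd[OF this]
  have T: "(?T has_derivative (\<lambda>u. dd u ?T ?z)) (at ?z)" .
  have Tz: "?T ?z = chart_map (slit_chart c') q"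
    using overlap(2)[OF zV] by (simp add: slit_chart_inv_map[OF c(1) q(1)])
  have "(local_fun c' f has_derivative (\<lambda>u. dd u (local_fun c' f) (?T ?z))) (at (?T ?z))"
    unfolding Tz by (rule smooth_on_has_derivative[OF smooth_on_local_fun[OF f c(2)] slit_chart_map_in_range[OF q(2)]])
  from has_derivative_compose[OF T this]
  have "dd u (\<lambda>z. local_fun c' f (?T z)) ?z = dd (dd u ?T ?z) (local_fun c' f) (chart_map (slit_chart c') q)" for u
    unfolding Tz by (rule dd_eqI)
  moreover have "dd u (\<lambda>z. local_fun c' f (?T z)) ?z = dd u (local_fun c f) ?z" for u
    by (intro dd_cong[OF oV zV]) (simp add: overlap(2) slit_chart_inv_map[OF c(2) overlap(1)])
  moreover have "S q (slit_chart c') = dd (S q (slit_chart c)) ?T ?z"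
  proof -
    have "slit_chart c \<in> charts_at (slit_atlas A) q" "slit_chart c' \<in> charts_at (slit_atlas A) q"
      using c q by (auto simp: charts_at_slit_atlas)
    moreover have "q \<in> points (slit_atlas A)" using c q by (auto simp: points_def slit_atlas_def)
    ultimately show ?thesis
      using S unfolding spray_def smooth_vfield_def tangent_space_def dd_def by blast
  qed
  ultimately show ?thesis by (simp add: chart_deriv_def dd_def)
qed

text \<open>Connectedness is given for the base. Slit fibres are connected in dimension at least
  two, so \<open>G\<close> is constant over each coordinate ball and descends to a locally constant
  function on the base.\<close>

lemma constant_on_slit_bundle:
  assumes conn: "connected_space (manifold_topology A)" and dim: "2 \<le> DIM('e)"
    and G: "\<And>c z. c \<in> A \<Longrightarrow> z \<in> slit_range c \<Longrightarrow> (local_fun c G has_derivative (\<lambda>_. 0)) (at z)"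
  shows "\<exists>k. \<forall>q\<in>slit_bundle A. (G q :: real) = k"
proof -
  let ?X = "manifold_topology A"
  \<comment> \<open>The level sets of the descended function; they will be open, disjoint and cover
    the base.\<close>
  define T where "T k = {p \<in> points A. \<forall>v. (p, v) \<in> slit_bundle A \<longrightarrow> G (p, v) = k}" for k
  have top: "topspace ?X = points A"
  proof (intro equalityI subsetI)
    fix p assume "p \<in> points A"
    then obtain c where c: "c \<in> A" "p \<in> chart_dom c" by (auto simp: points_def)
    have "chart_dom c \<inter> chart_map c -` UNIV \<in> {chart_dom c \<inter> chart_map c -` W |c W. c \<in> A \<and> open W}"
      using c(1) open_UNIV by blast
    then show "p \<in> topspace ?X"
      unfolding manifold_topology_def topology_generated_by_topspace using c(2) by auto
  next
    fix p assume "p \<in> topspace ?X"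
    then show "p \<in> points A"
      unfolding manifold_topology_def topology_generated_by_topspace points_def by blast
  qed
  have nbhd: "\<exists>N k. openin ?X N \<and> p \<in> N \<and> N \<subseteq> T k" if p: "p \<in> points A" for p
  proof -
    obtain c where c: "c \<in> A" "p \<in> chart_dom c" using p by (auto simp: points_def)
    then have "chart_map c p \<in> chart_range c" by (simp add: chart_range_def)
    then obtain e where e: "e > 0" "ball (chart_map c p) e \<subseteq> chart_range c"
      using open_chart_range[OF c(1)] open_contains_ball by blast
    let ?B = "ball (chart_map c p) e \<times> (- {0::'e})"
    have B: "?B \<subseteq> slit_range c" using e by (auto simp: slit_chart_range[OF c(1)])
    \<comment> \<open>In dimension one the punctured fibre would have two components.\<close>
    have "connected ?B"
      by (intro connected_Times connected_punctured_universe dim) simp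
    moreover have "open ?B" by (intro open_Times) auto
    ultimately have const: "local_fun c G z = local_fun c G z'" if "z \<in> ?B" "z' \<in> ?B" for z z'
      using that G[OF c(1)] B by (intro has_derivative_zero_unique_connected[of ?B]) blast+
    obtain b :: 'e where "b \<in> Basis" using nonempty_Basis by blast
    then have b: "(chart_map c p, b) \<in> ?B" using e by auto
    let ?N = "chart_dom c \<inter> chart_map c -` ball (chart_map c p) e"
    have "openin ?X ?N"
      unfolding manifold_topology_def by (rule topology_generated_by_Basis) (use c in blast)
    moreover have "?N \<subseteq> T (local_fun c G (chart_map c p, b))"
    proof
      fix r assume r: "r \<in> ?N"
      have "G (r, v) = local_fun c G (chart_map c p, b)" if v: "(r, v) \<in> slit_bundle A" for v
      proof -
        have q: "(r, v) \<in> chart_dom (slit_chart c)" using r v by (simp add: slit_chart_simps)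
        have "chart_map (slit_chart c) (r, v) \<in> ?B"
          using r slit_chart_nonzero[OF c(1) q] by (simp add: slit_chart_simps)
        from const[OF this b] show ?thesis by (simp add: slit_chart_inv_map[OF c(1) q])
      qed
      moreover have "r \<in> points A" using r c(1) by (auto simp: points_def)
      ultimately show "r \<in> T (local_fun c G (chart_map c p, b))" unfolding T_def by blast
    qed
    moreover have "p \<in> ?N" using c e by simp
    ultimately show ?thesis by blast
  qed
  \<comment> \<open>Every base point carries a nonzero tangent vector, so the condition in
    \<open>T\<close> is never vacuous and the level sets are disjoint.\<close>
  have T_unique: "k = k'" if "p \<in> T k" "p \<in> T k'" for p k k'
  proof -
    have "p \<in> points A" using that unfolding T_def by blast
    then obtain c where c: "c \<in> charts_at A p" by (auto simp: points_def charts_at_def)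
    obtain b :: 'e where b: "b \<in> Basis" using nonempty_Basis by blast
    obtain v where v: "v \<in> tangent_space A p" "v c = b" using tangent_space_exists[OF c] by metis
    have "(p, v) \<in> slit_bundle A"
      using v nonzero_Basis[OF b] \<open>p \<in> points A\<close> by (auto simp: slit_bundle_iff)
    then have "G (p, v) = k" "G (p, v) = k'" using that unfolding T_def by blast+
    then show ?thesis by simp
  qed
  have open_T: "openin ?X (T k)" for k
  proof (subst openin_subopen, intro ballI)
    fix p assume p: "p \<in> T k"
    then have "p \<in> points A" unfolding T_def by blast
    from nbhd[OF this] obtain N k' where N: "openin ?X N" "p \<in> N" "N \<subseteq> T k'" by blast
    moreover have "k' = k" using T_unique[OF subsetD[OF N(3,2)] p] .
    ultimately show "\<exists>N. openin ?X N \<and> p \<in> N \<and> N \<subseteq> T k" by blast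
  qed
  show ?thesis
  proof (cases "points A = {}")
    case True
    then have "slit_bundle A = {}" by (auto simp: slit_bundle_iff)
    then show ?thesis by simp
  next
    case False
    then obtain p0 where "p0 \<in> points A" by blast
    from nbhd[OF this] obtain k0 where p0: "p0 \<in> T k0" by blast
    \<comment> \<open>The other level sets form an open complement, so \<open>T k0\<close> is closed
      as well as open.\<close>
    have "points A - T k0 = (\<Union>k\<in>-{k0}. T k)"
    proof (intro equalityI subsetI)
      fix p assume p: "p \<in> points A - T k0"
      then obtain k where "p \<in> T k" using nbhd[of p] by blast
      then show "p \<in> (\<Union>k\<in>-{k0}. T k)" using p by blast
    next
      fix p assume "p \<in> (\<Union>k\<in>-{k0}. T k)"
      then obtain k where k: "k \<noteq> k0" "p \<in> T k" by blast
      then have "p \<notin> T k0" using T_unique by blast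
      moreover have "p \<in> points A" using k unfolding T_def by blast
      ultimately show "p \<in> points A - T k0" by blast
    qed
    moreover have "openin ?X (\<Union>k\<in>-{k0}. T k)" by (rule openin_Union) (use open_T in blast)
    moreover have "T k0 \<subseteq> points A" unfolding T_def by blast
    ultimately have "closedin ?X (T k0)" by (simp only: closedin_def top)
    then have "T k0 = points A"
      using conn[unfolded connected_space_clopen_in top, THEN spec, of "T k0"] open_T[of k0] p0 by blast
    then have "G q = k0" if q: "q \<in> slit_bundle A" for q
    proof -
      have "fst q \<in> T k0" using q \<open>T k0 = points A\<close> by (simp only: slit_bundle_iff)
      then have "(fst q, v) \<in> slit_bundle A \<longrightarrow> G (fst q, v) = k0" for v unfolding T_def by blast
      from this[of "snd q"] show ?thesis using q by simp
    qed
    then show ?thesis by blast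
  qed
qed

end

section \<open>Finsler metrics\<close>

lemma dd_snd_expand:
  fixes f :: "(real^'n) \<times> (real^'n) \<Rightarrow> real"
  assumes "smooth_on W f" "z \<in> W"
  shows "dd (0, u) f z = (\<Sum>i\<in>UNIV. u $ i * dd (0, axis i 1) f z)"
proof -
  have lin: "linear (\<lambda>u. dd (0, u) f z)"
    by (rule linearI) (simp_all add: dd_lin_snd[OF assms])
  have "dd (0, u) f z = dd (0, \<Sum>i\<in>UNIV. u $ i *\<^sub>R axis i 1) f z"
    using basis_expansion[of u] by (simp add: scalar_mult_eq_scaleR)
  also have "\<dots> = (\<Sum>i\<in>UNIV. u $ i * dd (0, axis i 1) f z)"
    by (simp only: linear_sum[OF lin] linear_scale[OF lin] real_scaleR_def)
  finally show ?thesis .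
qed

locale finsler_manifold = atlas A for A :: "('m, real^'n) chart set" +
  fixes F :: "('m, real^'n) tangent \<Rightarrow> real"
  assumes finsler: "finsler_metric A F"
begin

definition energy :: "('m, real^'n) chart \<Rightarrow> (real^'n) \<times> (real^'n) \<Rightarrow> real" where
  "energy c = local_fun c (\<lambda>q. (F q)\<^sup>2)"

lemma smooth_F: "smooth_function (slit_atlas A) F"
  using finsler by (simp add: finsler_metric_def)

lemma energy_eq: "energy c z = (local_fun c F z)\<^sup>2"
  by (simp add: energy_def)

lemma smooth_F_squared: "smooth_function (slit_atlas A) (\<lambda>q. (F q)\<^sup>2)"
  unfolding smooth_function_def
proof
  fix C assume "C \<in> slit_atlas A"
  then obtain c where c: "c \<in> A" "C = slit_chart c" by (auto simp: slit_atlas_def)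
  have "smooth_on (slit_range c) (\<lambda>z. (local_fun c F z)\<^sup>2)"
    by (intro smooth_on_power open_slit_chart_range smooth_on_local_fun smooth_F c)
  then show "smooth_on (chart_range C) ((\<lambda>q. (F q)\<^sup>2) \<circ> chart_inv C)" by (simp add: c o_def)
qed

lemma smooth_energy: "c \<in> A \<Longrightarrow> smooth_on (slit_range c) (energy c)"
  unfolding energy_def by (rule smooth_on_local_fun[OF smooth_F_squared])

lemma homog_energy: "c \<in> A \<Longrightarrow> homog (slit_range c) 2 (energy c)"
proof -
  assume c: "c \<in> A"
  have "pos_homogeneous_on (slit_bundle A) 2 (\<lambda>q. (F q)\<^sup>2)"
    using finsler by (auto simp: finsler_metric_def pos_homogeneous_on_def slit_bundle_def power_mult_distrib)
  from homog_local_fun[OF smooth_F_squared c this] show ?thesis by (simp add: energy_def)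
qed

lemma energy_pos: "z \<in> slit_range c \<Longrightarrow> energy c z > 0"
proof -
  assume "z \<in> slit_range c"
  then have "point c z \<in> slit_bundle A" using slit_chart_inv(1) slit_chart_simps(1) by blast
  then have "F (point c z) > 0" using finsler unfolding finsler_metric_def by blast
  then show ?thesis by (simp add: energy_eq)
qed

lemma dd_energy:
  assumes "c \<in> A" "z \<in> slit_range c"
  shows "dd u (energy c) z = 2 * (local_fun c F z * dd u (local_fun c F) z)"
proof -
  note F = smooth_on_has_derivative[OF smooth_on_local_fun[OF smooth_F assms(1)] assms(2)]
  show ?thesis
    unfolding energy_eq[abs_def] power2_eq_square by (rule dd_eqI[OF has_derivative_mult[OF F F], THEN trans]) simp
qed

text \<open>Expanding both derivatives in the standard basis gives twice the quadratic form of the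
  metric tensor, the factor undoing the \<open>1/2\<close> in its definition.\<close>

lemma energy_convex:
  assumes c: "c \<in> A" and z: "z \<in> slit_range c" and "u \<noteq> 0"
  shows "dd (0, u) (dd (0, u) (energy c)) z > 0"
proof -
  let ?E = "energy c" and ?q = "point c z"
  have q: "?q \<in> slit_bundle A" "slit_chart c \<in> charts_at (slit_atlas A) ?q"
    using slit_chart_inv(1)[OF z] c by (auto simp: slit_chart_simps charts_at_slit_atlas)
  have M: "metric_tensor F ?q (slit_chart c) $ i $ j = 1/2 * dd (0, axis i 1) (dd (0, axis j 1) ?E) z" for i j
    unfolding metric_tensor_def by (simp add: dy_def[abs_def] dd_def[abs_def] slit_chart_inv(2)[OF z] energy_def o_def)
  have "dd (0, u) (dd (0, u) ?E) z = dd (0, u) (\<lambda>w. \<Sum>j\<in>UNIV. u $ j * dd (0, axis j 1) ?E w) z"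
    by (intro dd_cong[OF open_slit_chart_range[OF c] z] dd_snd_expand[OF smooth_energy[OF c]])
  also have "\<dots> = (\<Sum>j\<in>UNIV. u $ j * dd (0, u) (dd (0, axis j 1) ?E) z)"
    by (rule dd_eqI) (intro has_derivative_sum has_derivative_mult_right
        smooth_on_has_derivative[OF smooth_on_dd[OF smooth_energy[OF c]] z])
  also have "\<dots> = (\<Sum>j\<in>UNIV. \<Sum>i\<in>UNIV. u $ j * (u $ i * dd (0, axis i 1) (dd (0, axis j 1) ?E) z))"
    by (simp only: dd_snd_expand[OF smooth_on_dd[OF smooth_energy[OF c]] z, of u] sum_distrib_left)
  also have "\<dots> = (\<Sum>i\<in>UNIV. \<Sum>j\<in>UNIV. u $ j * (u $ i * dd (0, axis i 1) (dd (0, axis j 1) ?E) z))"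
    by (rule sum.swap)
  also have "\<dots> = 2 * (u \<bullet> (metric_tensor F ?q (slit_chart c) *v u))"
    by (simp add: inner_vec_def matrix_vector_mult_def M sum_distrib_left mult_ac)
  also have "\<dots> > 0"
    using finsler q assms(3) by (simp add: finsler_metric_def)
  finally show ?thesis .
qed

text \<open>Evaluating \<open>i_S d d_J E = - d E\<close> on \<open>(a, 0)\<close> yields the
  Euler-Lagrange equation.\<close>

lemma geodesic_slit_chart:
  assumes S: "geodesic_spray A F S" and c: "c \<in> A" and z: "z \<in> slit_range c"
  shows "spray_deriv (spray_coeff c S) (dd (0, a) (energy c)) z = dd (a, 0) (energy c) z"
proof -
  have sp: "spray A S" using S by (simp add: geodesic_spray_def)
  have "ins_vfield S (ext_d (d_tensor vert_endo (fun_form (\<lambda>q. (F q)\<^sup>2)))) (point c z) (slit_chart c) [(a, 0)] =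
      - ext_d (fun_form (\<lambda>q. (F q)\<^sup>2)) (point c z) (slit_chart c) [(a, 0)]"
    using S c z unfolding geodesic_spray_def form_eq_def ball_slit_atlas by blast
  then have "dd (snd z, spray_coeff c S z) (dd (0, a) (energy c)) z - dd (a, 0) (dd (0, snd z) (energy c)) z = - dd (a, 0) (energy c) z"
    by (simp add: ins_vfield_def ext_d_vert_endo_slit_chart[OF c z] spray_slit_chart[OF sp c z] ext_d_fun_form
        chart_deriv_slit_chart[OF z] energy_def)
  \<comment> \<open>The direction \<open>snd z\<close> is frozen, so the derivatives commute and
    Euler's relation applies to the base derivative, again of degree two.\<close>
  moreover have "dd (a, 0) (dd (0, snd z) (energy c)) z = 2 * dd (a, 0) (energy c) z"
    using homog_dd[OF open_slit_chart_range[OF c] smooth_energy[OF c] homog_energy[OF c] z, of "(a, 0)"]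
    by (simp add: dd_commute[OF open_slit_chart_range[OF c] smooth_energy[OF c] z, of "(a, 0)"]
        dd_lin_snd(5)[OF smooth_energy[OF c] z])
  ultimately show ?thesis by (simp add: spray_deriv_def)
qed

text \<open>By the Euler-Lagrange equations, the vertical difference \<open>a\<close> of two
  geodesic sprays satisfies \<open>V\<^sub>a V\<^sub>a E = 0\<close>; convexity forces it to
  vanish.\<close>

lemma geodesic_spray_unique:
  assumes S: "geodesic_spray A F S" and S': "geodesic_spray A F S'" and c: "c \<in> A" and z: "z \<in> slit_range c"
  shows "spray_coeff c S z = spray_coeff c S' z"
proof (rule ccontr)
  let ?a = "spray_coeff c S z - spray_coeff c S' z"
  assume "spray_coeff c S z \<noteq> spray_coeff c S' z"
  then have "dd (0, ?a) (dd (0, ?a) (energy c)) z > 0" by (intro energy_convex[OF c z]) simp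
  moreover have "dd (0, ?a) (dd (0, ?a) (energy c)) z =
      dd (snd z, spray_coeff c S z) (dd (0, ?a) (energy c)) z - dd (snd z, spray_coeff c S' z) (dd (0, ?a) (energy c)) z"
    using dd_lin(2)[OF smooth_on_dd[OF smooth_energy[OF c]] z, of "(snd z, spray_coeff c S z)" "(snd z, spray_coeff c S' z)"]
    by simp
  ultimately show False
    using geodesic_slit_chart[OF S c z, of ?a] geodesic_slit_chart[OF S' c z, of ?a] by (simp add: spray_deriv_def)
qed

text \<open>The definition asks for some geodesic spray, which uniqueness replaces by the given
  \<open>S\<close>. The term \<open>F d_J F\<close> becomes half the vertical derivative of the
  energy.\<close>

lemma constant_flag_curvature_iff:
  assumes S: "geodesic_spray A F S"
  shows "constant_flag_curvature A F \<longleftrightarrow> (\<exists>k. \<forall>c\<in>A. \<forall>z\<in>slit_range c. \<forall>a.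
    curv (spray_coeff c S) a z = k *\<^sub>R (energy c z *\<^sub>R a - (1/2 * dd (0, a) (energy c) z) *\<^sub>R snd z))"
proof -
  have local: "tensor_eq (slit_atlas A) (jacobi_endo S')
          (\<lambda>q c u. \<kappa> q *\<^sub>R ((F q)\<^sup>2 *\<^sub>R vert_endo q c u -
             (F q * d_tensor vert_endo (fun_form F) q c [u]) *\<^sub>R liouville q c)) \<longleftrightarrow>
     (\<forall>c\<in>A. \<forall>z\<in>slit_range c. \<forall>a.
    curv (spray_coeff c S) a z = \<kappa> (point c z) *\<^sub>R (energy c z *\<^sub>R a - (1/2 * dd (0, a) (energy c) z) *\<^sub>R snd z))"
    if S': "geodesic_spray A F S'" for S' \<kappa>
    unfolding tensor_eq_def ball_slit_atlas
  proof (intro ball_cong refl)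
    fix c z assume c: "c \<in> A" and z: "z \<in> slit_range c"
    have sp: "spray A S'" using S' by (simp add: geodesic_spray_def)
    have eq: "curv (spray_coeff c S') a z = curv (spray_coeff c S) a z" for a
      by (rule curv_cong[OF open_slit_chart_range[OF c] z geodesic_spray_unique[OF S' S c]])
    have "(jacobi_endo S' (point c z) (slit_chart c) u =
        \<kappa> (point c z) *\<^sub>R ((F (point c z))\<^sup>2 *\<^sub>R vert_endo (point c z) (slit_chart c) u -
          (F (point c z) * d_tensor vert_endo (fun_form F) (point c z) (slit_chart c) [u]) *\<^sub>R liouville (point c z) (slit_chart c)))
      \<longleftrightarrow> curv (spray_coeff c S) (fst u) z =
        \<kappa> (point c z) *\<^sub>R (energy c z *\<^sub>R fst u - (1/2 * dd (0, fst u) (energy c) z) *\<^sub>R snd z)" for u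
      by (simp add: jacobi_endo_slit_chart[OF sp c z] d_vert_endo_slit_chart[OF z] liouville_slit_chart[OF z]
          vert_endo_def eq dd_energy[OF c z] energy_eq)
    then show "(\<forall>u. jacobi_endo S' (point c z) (slit_chart c) u =
        \<kappa> (point c z) *\<^sub>R ((F (point c z))\<^sup>2 *\<^sub>R vert_endo (point c z) (slit_chart c) u -
          (F (point c z) * d_tensor vert_endo (fun_form F) (point c z) (slit_chart c) [u]) *\<^sub>R liouville (point c z) (slit_chart c)))
      \<longleftrightarrow> (\<forall>a. curv (spray_coeff c S) a z =
        \<kappa> (point c z) *\<^sub>R (energy c z *\<^sub>R a - (1/2 * dd (0, a) (energy c) z) *\<^sub>R snd z))"
      by (metis fst_conv)
  qed
  show ?thesis
  proof
    assume "constant_flag_curvature A F"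
    then obtain \<kappa> k S' where \<kappa>: "\<forall>q\<in>slit_bundle A. \<kappa> q = k" and S': "geodesic_spray A F S'"
      and t: "tensor_eq (slit_atlas A) (jacobi_endo S')
          (\<lambda>q c u. \<kappa> q *\<^sub>R ((F q)\<^sup>2 *\<^sub>R vert_endo q c u -
             (F q * d_tensor vert_endo (fun_form F) q c [u]) *\<^sub>R liouville q c))"
      unfolding constant_flag_curvature_def flag_curvature_def by blast
    have "\<kappa> (point c z) = k" if "c \<in> A" "z \<in> slit_range c" for c z
      using \<kappa> slit_chart_inv(1)[OF that(2)] by (simp add: slit_chart_simps)
    then show "\<exists>k. \<forall>c\<in>A. \<forall>z\<in>slit_range c. \<forall>a.
      curv (spray_coeff c S) a z = k *\<^sub>R (energy c z *\<^sub>R a - (1/2 * dd (0, a) (energy c) z) *\<^sub>R snd z)"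
      using t unfolding local[OF S'] by (intro exI[of _ k]) simp
  next
    assume "\<exists>k. \<forall>c\<in>A. \<forall>z\<in>slit_range c. \<forall>a.
      curv (spray_coeff c S) a z = k *\<^sub>R (energy c z *\<^sub>R a - (1/2 * dd (0, a) (energy c) z) *\<^sub>R snd z)"
    then obtain k where "\<forall>c\<in>A. \<forall>z\<in>slit_range c. \<forall>a.
      curv (spray_coeff c S) a z = k *\<^sub>R (energy c z *\<^sub>R a - (1/2 * dd (0, a) (energy c) z) *\<^sub>R snd z)" by blast
    then have "tensor_eq (slit_atlas A) (jacobi_endo S)
          (\<lambda>q c u. k *\<^sub>R ((F q)\<^sup>2 *\<^sub>R vert_endo q c u -
             (F q * d_tensor vert_endo (fun_form F) q c [u]) *\<^sub>R liouville q c))"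
      using local[OF S, of "\<lambda>_. k"] by blast
    moreover have "smooth_function (slit_atlas A) (\<lambda>_. k)"
      unfolding smooth_function_def slit_atlas_def o_def using smooth_on_const[OF open_slit_chart_range] by auto
    moreover have "pos_homogeneous_on (slit_bundle A) 0 (\<lambda>_. k)" by (simp add: pos_homogeneous_on_def)
    ultimately show "constant_flag_curvature A F"
      unfolding constant_flag_curvature_def flag_curvature_def using S by (intro exI[of _ "\<lambda>_. k"]) blast
  qed
qed

end

section \<open>Assembly of the chart results over the manifold\<close>

theorem theorem3p2:
  fixes A :: "('m, real^'n) chart set"
    and F F' P :: "('m, real^'n) tangent \<Rightarrow> real"
    and S S' :: "(('m, real^'n) tangent, (real^'n) \<times> (real^'n)) vfield"
  assumes "smooth_manifold A" and "connected_space (manifold_topology A)" and "CARD('n) > 1"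
    and "finsler_metric A F" and "finsler_metric A F'"
    and "geodesic_spray A F S" and "geodesic_spray A F' S'"
    and "projective_factor A S S' P"
    and "constant_flag_curvature A F"
  shows "constant_flag_curvature A F' \<longleftrightarrow> hamel_function A S P"
proof -
  interpret F: finsler_manifold A F
    using assms(1,4) by unfold_locales (simp_all add: smooth_manifold_def)
  interpret F': finsler_manifold A F'
    using assms(5) by unfold_locales
  let ?s = "\<lambda>c. F.spray_coeff c S" and ?s' = "\<lambda>c. F.spray_coeff c S'" and ?P = "\<lambda>c. F.local_fun c P"
  have spray: "spray A S" "spray A S'" using assms(6,7) by (simp_all add: geodesic_spray_def)
  have P: "smooth_function (slit_atlas A) P" "pos_homogeneous_on (slit_bundle A) 1 P"
    and deformation: "vfield_eq (slit_atlas A) S' (\<lambda>q c. S q c - (2 * P q) *\<^sub>R liouville q c)"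
    using assms(8) by (simp_all add: projective_factor_def)
  have dim: "2 \<le> DIM(real^'n)" using assms(3) by simp
  have pair: "projective_pair (F.slit_range c) (?s c) (?s' c) (?P c)" if c: "c \<in> A" for c
  proof -
    interpret s: coord_spray "F.slit_range c" "?s c" by (rule F.coord_spray_slit_chart[OF spray(1) c])
    interpret s': coord_spray "F.slit_range c" "?s' c" by (rule F.coord_spray_slit_chart[OF spray(2) c])
    show ?thesis
    proof
      show "smooth_on (F.slit_range c) (?P c)" by (rule F.smooth_on_local_fun[OF P(1) c])
      show "homog (F.slit_range c) 1 (?P c)" using F.homog_local_fun[OF P(1) c P(2)] by simp
      show "?s' c z = ?s c z - (2 * ?P c z) *\<^sub>R snd z" if z: "z \<in> F.slit_range c" for z
      proof -
        have "S' (F.point c z) (F.slit_chart c) =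
            S (F.point c z) (F.slit_chart c) - (2 * P (F.point c z)) *\<^sub>R liouville (F.point c z) (F.slit_chart c)"
          using deformation c z unfolding vfield_eq_def F.ball_slit_atlas by blast
        then show ?thesis by (simp add: F.spray_coeff_def F.liouville_slit_chart[OF z])
      qed
    qed
  qed
  obtain k where R: "curv (?s c) a z = k *\<^sub>R (F.energy c z *\<^sub>R a - (1/2 * dd (0, a) (F.energy c) z) *\<^sub>R snd z)"
    if "c \<in> A" "z \<in> F.slit_range c" for c a z
    using assms(9) unfolding F.constant_flag_curvature_iff[OF assms(6)] by blast
  show ?thesis
    unfolding F.hamel_function_iff[OF spray(1) P] F'.constant_flag_curvature_iff[OF assms(7)]
  proof
    assume "\<exists>k. \<forall>c\<in>A. \<forall>z\<in>F.slit_range c. \<forall>a.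
      curv (?s' c) a z = k *\<^sub>R (F'.energy c z *\<^sub>R a - (1/2 * dd (0, a) (F'.energy c) z) *\<^sub>R snd z)"
    then obtain k' where R': "curv (?s' c) a z = k' *\<^sub>R (F'.energy c z *\<^sub>R a - (1/2 * dd (0, a) (F'.energy c) z) *\<^sub>R snd z)"
      if "c \<in> A" "z \<in> F.slit_range c" for c a z by blast
    show "\<forall>c\<in>A. \<forall>z\<in>F.slit_range c. \<forall>a. spray_deriv (?s c) (dd (0, a) (?P c)) z = dd (a, 0) (?P c) z"
    proof (intro ballI allI)
      fix c z a assume c: "c \<in> A" and z: "z \<in> F.slit_range c"
      have nz: "snd z \<noteq> 0" if "z \<in> F.slit_range c" for z
        using that unfolding F.slit_chart_range[OF c] by auto
      show "spray_deriv (?s c) (dd (0, a) (?P c)) z = dd (a, 0) (?P c) z"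
        by (rule projective_pair.hamel_of_isotropic_pair[OF pair[OF c] F.smooth_energy[OF c] F'.smooth_energy[OF c]
              dim nz R[OF c] R'[OF c] z])
    qed
  next
    assume Q: "\<forall>c\<in>A. \<forall>z\<in>F.slit_range c. \<forall>a. spray_deriv (?s c) (dd (0, a) (?P c)) z = dd (a, 0) (?P c) z"
    define \<kappa> where "\<kappa> c = (\<lambda>z. (k * F.energy c z + (?P c z)\<^sup>2 - spray_deriv (?s c) (?P c) z) / F'.energy c z)" for c
    have local: "(\<kappa> c has_derivative (\<lambda>_. 0)) (at z)"
        "curv (?s' c) a z = \<kappa> c z *\<^sub>R (F'.energy c z *\<^sub>R a - (1/2 * dd (0, a) (F'.energy c) z) *\<^sub>R snd z)"
      if c: "c \<in> A" and z: "z \<in> F.slit_range c" for c z a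
    proof -
      interpret projective_pair "F.slit_range c" "?s c" "?s' c" "?P c" by (rule pair[OF c])
      note E = F.smooth_energy[OF c] F.homog_energy[OF c] and E' = F'.smooth_energy[OF c] F'.homog_energy[OF c]
      note * = hamel_curvature[OF E E' dim base.geodesic_energy(2)[OF E F.geodesic_slit_chart[OF assms(6) c]]
          deformed.geodesic_energy[OF E' F'.geodesic_slit_chart[OF assms(7) c]] F'.energy_pos F'.energy_convex[OF c]
          R[OF c] _ \<kappa>_def[of c] z]
      show "(\<kappa> c has_derivative (\<lambda>_. 0)) (at z)" by (rule *(1)) (use Q c in auto)
      show "curv (?s' c) a z = \<kappa> c z *\<^sub>R (F'.energy c z *\<^sub>R a - (1/2 * dd (0, a) (F'.energy c) z) *\<^sub>R snd z)"
        by (rule *(2)) (use Q c in auto)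
    qed
    \<comment> \<open>The derivative \<open>S P\<close> is computed in charts, so \<open>G\<close>
      needs one at each point. \<open>SOME\<close> picks a valid chart on the slit bundle, and chart
      independence makes the choice immaterial.\<close>
    define C where "C q = (SOME c. c \<in> A \<and> q \<in> chart_dom (F.slit_chart c))" for q
    define G where "G q = (k * (F q)\<^sup>2 + (P q)\<^sup>2 - chart_deriv (F.slit_chart (C q)) P q (S q (F.slit_chart (C q)))) / (F' q)\<^sup>2" for q
    have G: "F.local_fun c G z = \<kappa> c z" if c: "c \<in> A" and z: "z \<in> F.slit_range c" for c z
    proof -
      let ?q = "F.point c z"
      note q = F.slit_chart_inv(1)[OF z]
      have "C ?q \<in> A \<and> ?q \<in> chart_dom (F.slit_chart (C ?q))"
        unfolding C_def by (rule someI[of _ c]) (use c q in blast)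
      then have "chart_deriv (F.slit_chart (C ?q)) P ?q (S ?q (F.slit_chart (C ?q))) =
          chart_deriv (F.slit_chart c) P ?q (S ?q (F.slit_chart c))"
        using F.spray_deriv_chart_independent[OF P(1) spray(1)] c q by blast
      also have "\<dots> = spray_deriv (?s c) (?P c) z"
        by (simp add: F.chart_deriv_slit_chart[OF z] F.spray_slit_chart[OF spray(1) c z] spray_deriv_def)
      finally show ?thesis by (simp add: G_def \<kappa>_def F.energy_eq F'.energy_eq)
    qed
    have "(F.local_fun c G has_derivative (\<lambda>_. 0)) (at z)" if c: "c \<in> A" and z: "z \<in> F.slit_range c" for c z
      by (rule has_derivative_cong_open[OF F.open_slit_chart_range[OF c] z G[OF c], THEN iffD2, OF _ local(1)[OF c z]])
    from F.constant_on_slit_bundle[OF assms(2) dim this]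
    obtain k' where k': "\<And>q. q \<in> slit_bundle A \<Longrightarrow> G q = k'" by blast
    have "\<kappa> c z = k'" if "c \<in> A" "z \<in> F.slit_range c" for c z
      using G[OF that] k' F.slit_chart_inv(1)[OF that(2)] by (simp add: F.slit_chart_simps)
    then show "\<exists>k. \<forall>c\<in>A. \<forall>z\<in>F.slit_range c. \<forall>a.
      curv (?s' c) a z = k *\<^sub>R (F'.energy c z *\<^sub>R a - (1/2 * dd (0, a) (F'.energy c) z) *\<^sub>R snd z)"
      using local(2) by (intro exI[of _ k']) simp
  qed
qed

end
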